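(* Let $\varrho$ be a state on $\mathbb{C}^2\otimes\mathbb{C}^2\otimes\mathbb{C}^2$ (a three-qubit state). Then $\varrho$ is separable if and only if $$(I\otimes\tilde\Lambda)(\varrho)\ \ge\ 0$$ for every linear map $\tilde\Lambda:\mathcal{B}(\mathbb{C}^2\otimes\mathbb{C}^2)\to\mathcal{B}(\mathbb{C}^2)$ with the following property: for every state $\sigma$ on $\mathbb{C}^2$ there exist operators $A\ge 0$ and $B\ge 0$ on $\mathbb{C}^2\otimes\mathbb{C}^2$ (depending on $\sigma$) such that $$\tilde\Lambda^\dagger(\sigma)=A+B^{T_2}.$$
   Context: A state on a finite-dimensional complex Hilbert space is a positive semidefinite operator of trace one. $\mathcal{B}(\mathcal{H})$ denotes the algebra of all operators on $\mathcal{H}$. $X\ge 0$ means that $X$ is Hermitian with nonnegative eigenvalues. A state $\varrho$ on $\mathbb{C}^2\otimes\mathbb{C}^2\otimes\mathbb{C}^2$ is called separable if it can be approximated in trace norm by states of the form $\sum_{i=1}^k p_i\,\varrho_i^{1}\otimes\varrho_i^{2}\otimes\varrho_i^{3}$, where $p_i\ge 0$, $\sum_i p_i=1$, and each $\varrho_i^{l}$ is a state on $\mathbb{C}^2$. $I$ denotes the identity map on $\mathcal{B}(\mathbb{C}^2)$ (acting on the first qubit), so $I\otimes\tilde\Lambda$ maps $\mathcal{B}(\mathbb{C}^2\otimes\mathbb{C}^2\otimes\mathbb{C}^2)$ to $\mathcal{B}(\mathbb{C}^2\otimes\mathbb{C}^2)$. $\tilde\Lambda^\dagger:\mathcal{B}(\mathbb{C}^2)\to\mathcal{B}(\mathbb{C}^2\otimes\mathbb{C}^2)$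 is the adjoint of $\tilde\Lambda$ with respect to the Hilbert–Schmidt inner product $\langle X,Y\rangle=\mathrm{Tr}(X^\dagger Y)$. For $B\in\mathcal{B}(\mathbb{C}^2\otimes\mathbb{C}^2)$, $B^{T_2}=(I\otimes T)(B)$ is the partial transpose with respect to the second factor, where $T$ is matrix transposition in the standard basis. *)

theory Defs
  imports "HOL-Analysis.Analysis"
begin

text \<open>
  Operators on the Hilbert space with standard basis indexed by a finite type are complex
  square matrices over that type: index type \<open>2\<close> gives one qubit, product index types
  give tensor products.
\<close>

type_synonym 'n op = "complex^'n^'n"

definition scale_op :: "complex \<Rightarrow> 'n::finite op \<Rightarrow> 'n op" where
  "scale_op c X = (\<chi> i j. c * X $ i $ j)"

definition dagger :: "'n::finite op \<Rightarrow> 'n op" where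
  "dagger X = (\<chi> i j. cnj (X $ j $ i))"

definition hermitian :: "'n::finite op \<Rightarrow> bool" where
  "hermitian X \<longleftrightarrow> dagger X = X"

definition eigenvalue :: "'n::finite op \<Rightarrow> complex \<Rightarrow> bool" where
  "eigenvalue X c \<longleftrightarrow> (\<exists>v. v \<noteq> 0 \<and> X *v v = c *s v)"

definition psd :: "'n::finite op \<Rightarrow> bool" where
  "psd X \<longleftrightarrow> hermitian X \<and> (\<forall>c. eigenvalue X c \<longrightarrow> c \<in> \<real>\<^sub>\<ge>\<^sub>0)"

definition state :: "'n::finite op \<Rightarrow> bool" where
  "state X \<longleftrightarrow> psd X \<and> trace X = 1"

definition abs_op :: "'n::finite op \<Rightarrow> 'n op" where
  "abs_op X = (THE P. psd P \<and> P ** P = dagger X ** X)"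

text \<open>The trace of \<open>abs_op X\<close> is a nonnegative real, so taking the real part loses nothing.\<close>

definition trace_norm :: "'n::finite op \<Rightarrow> real" where
  "trace_norm X = Re (trace (abs_op X))"

definition tensor_op :: "'m::finite op \<Rightarrow> 'n::finite op \<Rightarrow> ('m \<times> 'n) op"
    (infixr "\<otimes>\<^sub>o" 75) where
  "A \<otimes>\<^sub>o B = (\<chi> p q. A $ fst p $ fst q * B $ snd p $ snd q)"

definition separable :: "(2 \<times> 2 \<times> 2) op \<Rightarrow> bool" where
  "separable \<rho> \<longleftrightarrow>
    (\<forall>\<epsilon>>0. \<exists>(k::nat) (p :: nat \<Rightarrow> real) (\<rho>1 :: nat \<Rightarrow> 2 op) (\<rho>2 :: nat \<Rightarrow> 2 op) (\<rho>3 :: nat \<Rightarrow> 2 op).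
      (\<forall>i<k. 0 \<le> p i \<and> state (\<rho>1 i) \<and> state (\<rho>2 i) \<and> state (\<rho>3 i)) \<and>
      (\<Sum>i<k. p i) = 1 \<and>
      trace_norm (\<rho> - (\<Sum>i<k. scale_op (of_real (p i)) (\<rho>1 i \<otimes>\<^sub>o \<rho>2 i \<otimes>\<^sub>o \<rho>3 i))) < \<epsilon>)"

definition linear_op :: "('m::finite op \<Rightarrow> 'n::finite op) \<Rightarrow> bool" where
  "linear_op \<Lambda> \<longleftrightarrow> Vector_Spaces.linear scale_op scale_op \<Lambda>"

definition hs_inner :: "'n::finite op \<Rightarrow> 'n op \<Rightarrow> complex" where
  "hs_inner X Y = trace (dagger X ** Y)"

definition hs_adjoint :: "('m::finite op \<Rightarrow> 'n::finite op) \<Rightarrow> 'n op \<Rightarrow> 'm op" where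
  "hs_adjoint \<Lambda> = (THE \<Lambda>'. \<forall>X Y. hs_inner (\<Lambda>' X) Y = hs_inner X (\<Lambda> Y))"

text \<open>
  The map \<open>I \<otimes> \<Lambda>\<close> applies \<open>\<Lambda>\<close> to each block of \<open>X\<close>, a block being obtained by fixing
  the row and column indices of the first factor. The lemmas \<open>id_tensor_tensor_op\<close> and
  \<open>linear_op_id_tensor\<close> below give its defining property.
\<close>

definition id_tensor ::
    "('m::finite op \<Rightarrow> 'n::finite op) \<Rightarrow> ('a::finite \<times> 'm) op \<Rightarrow> ('a \<times> 'n) op" where
  "id_tensor \<Lambda> X =
    (\<chi> p q. \<Lambda> (\<chi> k l. X $ (fst p, k) $ (fst q, l)) $ snd p $ snd q)"

definition partial_transpose :: "('a::finite \<times> 'n::finite) op \<Rightarrow> ('a \<times> 'n) op" where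
  "partial_transpose = id_tensor transpose"

lemma linear_op_iff:
  fixes \<Lambda> :: "'m::finite op \<Rightarrow> 'n::finite op"
  shows "linear_op \<Lambda> \<longleftrightarrow>
    (\<forall>X Y. \<Lambda> (X + Y) = \<Lambda> X + \<Lambda> Y) \<and> (\<forall>c X. \<Lambda> (scale_op c X) = scale_op c (\<Lambda> X))"
proof -
  have "vector_space (scale_op :: complex \<Rightarrow> 'm op \<Rightarrow> 'm op)"
    and "vector_space (scale_op :: complex \<Rightarrow> 'n op \<Rightarrow> 'n op)"
    by (unfold_locales; simp add: scale_op_def vec_eq_iff algebra_simps)+
  then show ?thesis
    unfolding linear_op_def Vector_Spaces.linear_def module_hom_def module_hom_axioms_def
    by (auto simp: module_iff_vector_space)
qed

lemma id_tensor_tensor_op: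
  assumes "linear_op \<Lambda>"
  shows "id_tensor \<Lambda> (A \<otimes>\<^sub>o B) = A \<otimes>\<^sub>o \<Lambda> B"
proof -
  have "\<Lambda> (\<chi> k l. c * B $ k $ l) = scale_op c (\<Lambda> B)" for c
    using assms by (auto simp: linear_op_iff scale_op_def [of c B, symmetric])
  then show ?thesis
    by (simp add: id_tensor_def tensor_op_def scale_op_def vec_eq_iff)
qed

lemma linear_op_id_tensor:
  assumes "linear_op \<Lambda>"
  shows "linear_op (id_tensor \<Lambda> :: ('a::finite \<times> _) op \<Rightarrow> _)"
proof -
  have add: "\<Lambda> (\<chi> k l. f k l + g k l) = \<Lambda> (\<chi> k l. f k l) + \<Lambda> (\<chi> k l. g k l)" for f g
  proof -
    have "(\<chi> k l. f k l + g k l) = (\<chi> k l. f k l) + (\<chi> k l. g k l)"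
      by (simp add: vec_eq_iff)
    then show ?thesis using assms by (simp add: linear_op_iff)
  qed
  have scale: "\<Lambda> (\<chi> k l. c * f k l) = scale_op c (\<Lambda> (\<chi> k l. f k l))" for c f
  proof -
    have "(\<chi> k l. c * f k l) = scale_op c (\<chi> k l. f k l)"
      by (simp add: vec_eq_iff scale_op_def)
    then show ?thesis using assms by (simp add: linear_op_iff)
  qed
  show ?thesis
    unfolding linear_op_iff
    by (simp add: id_tensor_def vec_eq_iff add scale) (simp add: scale_op_def add scale)
qed

lemma hs_inner_eq_sum: "hs_inner X Y = (\<Sum>i\<in>UNIV. \<Sum>j\<in>UNIV. cnj (X $ i $ j) * Y $ i $ j)"
  by (subst sum.swap) (simp add: hs_inner_def trace_def dagger_def matrix_matrix_mult_def)

lemma sum_sum_delta: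
  fixes f :: "'m::finite \<Rightarrow> 'n::finite \<Rightarrow> 'b::comm_monoid_add"
  shows "(\<Sum>i\<in>UNIV. \<Sum>j\<in>UNIV. if i = a \<and> j = b then f i j else 0) = f a b"
proof -
  have "(\<Sum>j\<in>UNIV. if i = a \<and> j = b then f i j else 0) = (if i = a then f i b else 0)" for i
    by (cases "i = a") simp_all
  then show ?thesis by simp
qed

lemma hs_inner_cancel:
  fixes X X' :: "'n::finite op"
  assumes "\<And>Y. hs_inner X Y = hs_inner X' Y"
  shows "X = X'"
proof -
  have "cnj (X $ a $ b) = cnj (X' $ a $ b)" for a b
    using assms [of "\<chi> i j. if i = a \<and> j = b then 1 else 0"]
    by (simp add: hs_inner_eq_sum if_distrib [of "\<lambda>x. _ * x"] sum_sum_delta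
        del: mult_cancel_left cong: if_cong)
  then show ?thesis by (simp add: vec_eq_iff)
qed

lemma hs_inner_hs_adjoint:
  fixes \<Lambda> :: "'m::finite op \<Rightarrow> 'n::finite op"
  assumes "linear_op \<Lambda>"
  shows "hs_inner (hs_adjoint \<Lambda> X) Y = hs_inner X (\<Lambda> Y)"
proof -
  define E where "E a b = (\<chi> i j. if i = a \<and> j = b then 1 else (0 :: complex))" for a b :: 'm
  define L where "L X = (\<chi> a b. cnj (hs_inner X (\<Lambda> (E a b))))" for X
  have add: "\<Lambda> (X + Y) = \<Lambda> X + \<Lambda> Y" and scale: "\<Lambda> (scale_op c X) = scale_op c (\<Lambda> X)" for X Y c
    using assms by (auto simp: linear_op_iff)
  have zero: "\<Lambda> 0 = 0" using add [of 0 0] by simp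
  have sum: "\<Lambda> (sum f S) = (\<Sum>i\<in>S. \<Lambda> (f i))" if "finite S" for f :: "'m \<Rightarrow> _" and S
    using that by (induction S rule: finite_induct) (auto simp: add zero)
  have inner_add: "hs_inner X (Y + Z) = hs_inner X Y + hs_inner X Z"
    and inner_scale: "hs_inner X (scale_op c Y) = c * hs_inner X Y" for X Y Z :: "'n op" and c
    by (auto simp: hs_inner_eq_sum algebra_simps sum.distrib sum_distrib_left scale_op_def)
  have inner_zero: "hs_inner X 0 = 0" for X :: "'n op" by (simp add: hs_inner_eq_sum)
  have inner_sum: "hs_inner X (sum f S) = (\<Sum>i\<in>S. hs_inner X (f i))" if "finite S"
    for X :: "'n op" and f :: "'m \<Rightarrow> _" and S
    using that by (induction S rule: finite_induct) (auto simp: inner_add inner_zero)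
  have decomp: "Y = (\<Sum>a\<in>UNIV. \<Sum>b\<in>UNIV. scale_op (Y $ a $ b) (E a b))" for Y
  proof -
    have "(\<Sum>a\<in>UNIV. \<Sum>b\<in>UNIV. Y $ a $ b * (if i = a \<and> j = b then 1 else 0)) = Y $ i $ j" for i j
      using sum_sum_delta [of i j "\<lambda>a b. Y $ a $ b"]
      by (simp add: if_distrib [of "\<lambda>x. _ * x"] eq_commute [of i] eq_commute [of j] cong: if_cong)
    then show ?thesis by (simp add: vec_eq_iff E_def scale_op_def)
  qed
  have L: "hs_inner (L X) Y = hs_inner X (\<Lambda> Y)" for X Y
    by (subst (2) decomp [of Y])
      (simp add: sum scale inner_sum inner_scale hs_inner_eq_sum [of "L X"],
        simp add: L_def mult.commute)
  have "\<forall>X Y. hs_inner (hs_adjoint \<Lambda> X) Y = hs_inner X (\<Lambda> Y)"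
    unfolding hs_adjoint_def
  proof (rule theI [where a = L])
    show "\<forall>X Y. hs_inner (L X) Y = hs_inner X (\<Lambda> Y)" using L by blast
  next
    fix L' assume "\<forall>X Y. hs_inner (L' X) Y = hs_inner X (\<Lambda> Y)"
    then show "L' = L" using L by (intro ext hs_inner_cancel) simp
  qed
  then show ?thesis by blast
qed

end

theory Submission
  imports Defs
begin

text \<open>
  A witness \<open>W\<close> separating \<open>\<rho>\<close> from the compact convex set of separable states is the
  Choi operator of a map \<open>\<Lambda>\<close> with \<open>\<langle>\<Omega>|(I \<otimes> \<Lambda>)(\<rho>)|\<Omega>\<rangle> = Tr (W \<rho>) < 0\<close>, and \<open>\<Lambda>\<^sup>\<dagger>(\<sigma>)\<close>
  is positive on product vectors for every state \<open>\<sigma>\<close>. It remains to show that a two-qubit operator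
  that is positive on product vectors is decomposable (Stormer, Woronowicz).
  By Krein--Milman it suffices to treat the extreme points \<open>W\<close> of a compact base of the cone.
  View \<open>W\<close> as a linear map \<open>F\<close> on Hermitian \<open>2 \<times> 2\<close> matrices that preserves positivity. The S-lemma
  gives \<open>m\<close> such that the quadratic form \<open>det (F X) - m det X\<close> is nonnegative. If it is not identically
  zero, then \<open>W\<close> can be moved in both directions along some \<open>U \<otimes> V\<close>, so extremality makes \<open>W\<close> a
  multiple of \<open>U \<otimes> V\<close>. If it vanishes, then \<open>F\<close> maps rank one to rank at most one, and the blocks of
  \<open>W\<close> can be written down explicitly.
\<close>

subsection \<open>Operators as sesquilinear forms\<close>

text \<open>On the real four-dimensional space of Hermitian 2 x 2 matrices the determinant is a
  quadratic form of signature (1,3), and its null vectors are plus or minus the matrices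
  \<open>y y*\<close>. Positivity of \<open>F\<close> on rank one therefore makes
  \<open>det (F X)\<close> nonnegative wherever \<open>det X\<close> vanishes, which is what the
  S-lemma asks for; this is where dimension two enters. The obstacle is to move \<open>W\<close>
  inside the cone uniformly over all product vectors, since some of them leave no room. The form
  \<open>B X X = det (F X) - m det X\<close> measures the room. Cauchy-Schwarz for \<open>B\<close>
  gives a functional \<open>v\<close> with \<open>(inner v X)^2 <= C * B X X\<close>, so a
  perturbation proportional to \<open>inner v X\<close> dies out wherever the room does. The opening
  is shaped by the definitions: positivity is stated through eigenvalues and the trace norm through
  a definite description. Eigenvalues are translated into quadratic forms, and the absolute value is
  shown to exist uniquely. The trace norm then enters through its domination of the Euclidean norm
  and its value at zero.\<close>

definition sform :: "'n::finite op \<Rightarrow> complex^'n \<Rightarrow> complex^'n \<Rightarrow> complex" where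
  "sform X v w = (\<Sum>i\<in>UNIV. \<Sum>j\<in>UNIV. cnj (v $ i) * X $ i $ j * w $ j)"

abbreviation qform :: "'n::finite op \<Rightarrow> complex^'n \<Rightarrow> complex" where
  "qform X v \<equiv> sform X v v"

definition outer :: "complex^'n::finite \<Rightarrow> 'n op" where
  "outer v = (\<chi> i j. v $ i * cnj (v $ j))"

lemma sform_add_left: "sform X (v + v') w = sform X v w + sform X v' w"
  and sform_add_right: "sform X v (w + w') = sform X v w + sform X v w'"
  and sform_scale_left: "sform X (c *s v) w = cnj c * sform X v w"
  and sform_scale_right: "sform X v (c *s w) = c * sform X v w"
  and sform_add_op: "sform (X + Y) v w = sform X v w + sform Y v w"
  and sform_diff_op: "sform (X - Y) v w = sform X v w - sform Y v w"
  and sform_minus_op: "sform (- X) v w = - sform X v w"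
  and sform_scaleR_op: "sform (r *\<^sub>R X) v w = of_real r * sform X v w"
  and sform_zero_op [simp]: "sform 0 v w = 0"
  and sform_zero_left [simp]: "sform X 0 w = 0"
  and sform_zero_right [simp]: "sform X v 0 = 0"
  by (simp_all add: sform_def scale_op_def scaleR_conv_of_real[where 'a = complex] algebra_simps sum.distrib
      sum_distrib_left sum_subtractf sum_negf)

lemma sform_axis: "sform X (axis i 1) (axis j 1) = X $ i $ j"
proof -
  have "sform X (axis i 1) (axis j 1)
      = (\<Sum>a\<in>UNIV. \<Sum>b\<in>UNIV. if a = i \<and> b = j then X $ a $ b else 0)"
    unfolding sform_def axis_def by (intro sum.cong refl) auto
  then show ?thesis by (simp add: sum_sum_delta)
qed

text \<open>Polarisation at \<open>e_i + e_j\<close> and \<open>e_i + i e_j\<close>: both the sum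
  and the difference of \<open>X $ i $ j\<close> and \<open>X $ j $ i\<close> vanish.\<close>

lemma sform_eq_zero_imp:
  assumes "\<And>v. qform X v = 0"
  shows "X = 0"
proof -
  have "X $ i $ j = 0" for i j
  proof -
    have "qform X (axis i 1 + axis j 1) = 0" "qform X (axis i 1 + \<i> *s axis j 1) = 0"
      "qform X (axis i 1) = 0" "qform X (axis j 1) = 0"
      using assms by blast+
    then have sum: "X $ i $ j + X $ j $ i = 0"
      and "\<i> * X $ i $ j - \<i> * X $ j $ i = 0"
      by (simp_all add: sform_add_left sform_add_right sform_scale_left sform_scale_right
          sform_axis)
    then have "\<i> * (X $ i $ j - X $ j $ i) = 0" by (simp only: right_diff_distrib)
    then have "X $ i $ j = X $ j $ i" by simp
    then show ?thesis using sum by simp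
  qed
  then show ?thesis by (simp add: vec_eq_iff)
qed

section \<open>Hermitian operators, lowest eigenvalues and positivity\<close>

lemma hermitian_iff: "hermitian X \<longleftrightarrow> (\<forall>i j. cnj (X $ i $ j) = X $ j $ i)"
  unfolding hermitian_def dagger_def vec_eq_iff vec_lambda_beta by metis

lemma sform_cnj:
  assumes "hermitian X"
  shows "cnj (sform X v w) = sform X w v"
proof -
  have "cnj (X $ i $ j) = X $ j $ i" for i j
    using assms by (simp add: hermitian_iff)
  then have "cnj (sform X v w) = (\<Sum>i\<in>UNIV. \<Sum>j\<in>UNIV. cnj (w $ j) * X $ j $ i * v $ i)"
    by (simp add: sform_def mult_ac)
  also have "\<dots> = sform X w v"
    unfolding sform_def by (rule sum.swap)
  finally show ?thesis .
qed

lemma Im_qform_hermitian: "hermitian X \<Longrightarrow> Im (qform X v) = 0"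
  using sform_cnj[of X v v] by (simp add: complex_eq_iff)

lemma hermitianI_qform:
  assumes "\<And>v. Im (qform X v) = 0"
  shows "hermitian X"
proof -
  have "cnj (X $ i $ j) = X $ j $ i" for i j
  proof -
    have "Im (qform X (axis i 1 + axis j 1)) = 0" "Im (qform X (axis i 1 + \<i> *s axis j 1)) = 0"
      "Im (qform X (axis i 1)) = 0" "Im (qform X (axis j 1)) = 0"
      using assms by blast+
    then show ?thesis
      by (simp add: sform_add_left sform_add_right sform_scale_left sform_scale_right
          sform_axis complex_eq_iff)
  qed
  then show ?thesis by (simp add: hermitian_iff)
qed

lemma sform_mat: "sform (mat 1) v w = (\<Sum>i\<in>UNIV. cnj (v $ i) * w $ i)"
  by (simp add: sform_def mat_def if_distrib[of "\<lambda>x. _ * x"] if_distrib[of "\<lambda>x. x * _"] cong: if_cong)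

lemma qform_mat: "qform (mat 1) v = of_real ((norm v)\<^sup>2)"
proof -
  have "(norm v)\<^sup>2 = (\<Sum>i\<in>UNIV. (norm (v $ i))\<^sup>2)"
    by (simp add: norm_vec_def L2_set_def sum_nonneg)
  then show ?thesis
    by (simp add: sform_mat complex_norm_square mult.commute del: of_real_power)
qed

lemma sform_mult_vec: "sform X v w = (\<Sum>i\<in>UNIV. cnj (v $ i) * (X *v w) $ i)"
  by (simp add: sform_def matrix_vector_mult_def sum_distrib_left mult.assoc)

lemma continuous_on_qform [continuous_intros]:
  assumes "continuous_on S f" "continuous_on S g"
  shows "continuous_on S (\<lambda>x. qform (f x) (g x))"
  unfolding sform_def by (intro continuous_intros assms continuous_on_component)

lemma norm_scale: "norm (c *s v) = cmod c * norm v" for v :: "complex^'n::finite"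
  by (simp add: norm_vec_def norm_mult L2_set_right_distrib)

lemma linear_term_zero:
  fixes a b :: real
  assumes "\<And>t. 0 \<le> t * a + t\<^sup>2 * b"
  shows "a = 0"
proof (rule ccontr)
  assume "a \<noteq> 0"
  define c where "c = \<bar>b\<bar> + 1"
  \<comment> \<open>Since \<open>b <= c - 1\<close>, the value at \<open>- a / c\<close> is at most
    \<open>- (a / c)^2\<close>.\<close>
  define t where "t = - a / c"
  have "0 < c" by (simp add: c_def)
  have "t\<^sup>2 * b \<le> t\<^sup>2 * (c - 1)" by (simp add: c_def mult_left_mono)
  then have "0 \<le> t * a + t\<^sup>2 * (c - 1)" using assms[of t] by linarith
  also have "\<dots> = - (a\<^sup>2 / c\<^sup>2)"
    using \<open>0 < c\<close> by (simp add: t_def field_simps power2_eq_square)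
  finally have "a\<^sup>2 / c\<^sup>2 \<le> 0" by simp
  moreover have "0 < a\<^sup>2 / c\<^sup>2" using \<open>a \<noteq> 0\<close> \<open>0 < c\<close> by simp
  ultimately show False by linarith
qed

text \<open>Variational principle: by compactness the form attains its minimum on the unit sphere,
  and a minimiser is an eigenvector.\<close>

lemma qform_min_eigenvalue:
  fixes X :: "'n::finite op"
  assumes "hermitian X"
  obtains m where "eigenvalue X (of_real m)" "\<And>v. m * (norm v)\<^sup>2 \<le> Re (qform X v)"
proof -
  have "sphere (0 :: complex^'n) 1 \<noteq> {}"
    by simp
  moreover have "continuous_on (sphere (0 :: complex^'n) 1) (\<lambda>w. Re (qform X w))"
    by (intro continuous_intros)
  ultimately obtain v where v: "v \<in> sphere (0 :: complex^'n) 1"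
    and min: "\<And>w. w \<in> sphere 0 1 \<Longrightarrow> Re (qform X v) \<le> Re (qform X w)"
    using continuous_attains_inf[OF compact_sphere, of 0 1 "\<lambda>w. Re (qform X w)"] by blast
  define m where "m = Re (qform X v)"
  have lower: "m * (norm w)\<^sup>2 \<le> Re (qform X w)" for w
  proof (cases "w = 0")
    case False
    have "m \<le> Re (qform X (of_real (1 / norm w) *s w))"
      unfolding m_def using False
      by (intro min) (simp add: norm_scale norm_divide)
    also have "\<dots> = Re (qform X w) / (norm w)\<^sup>2"
      by (simp add: sform_scale_left sform_scale_right power2_eq_square)
    finally show ?thesis using False by (simp add: field_simps)
  qed simp
  define y where "y = X *v v - of_real m *s v"
  have "X *v v = of_real m *s v"
  proof -
    \<comment> \<open>The form of \<open>Y\<close> is nonnegative and vanishes at \<open>v\<close>,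
      so moving \<open>v\<close> along \<open>y = Y v\<close> has no linear term; that term is twice
      the squared norm of \<open>y\<close>.\<close>
    define Y where "Y = X - m *\<^sub>R mat 1"
    have Yh: "hermitian Y"
      using assms by (auto simp: Y_def hermitian_iff mat_def)
    have qY: "0 \<le> Re (qform Y w)" for w
      using lower[of w] by (simp add: Y_def sform_diff_op sform_scaleR_op qform_mat flip: of_real_power)
    have "qform Y v = 0"
      using v Im_qform_hermitian[OF Yh, of v]
      by (simp add: Y_def sform_diff_op sform_scaleR_op qform_mat m_def complex_eq_iff)
    have "Re (sform Y y v) = 0"
    proof -
      have "0 \<le> t * (2 * Re (sform Y y v)) + t\<^sup>2 * Re (qform Y y)" for t
        using qY[of "v + of_real t *s y"] \<open>qform Y v = 0\<close> sform_cnj[OF Yh, of y v, symmetric]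
        by (simp add: sform_add_left sform_add_right sform_scale_left sform_scale_right
            power2_eq_square algebra_simps)
      from linear_term_zero[OF this] show ?thesis by simp
    qed
    moreover have "sform Y y v = qform (mat 1) y"
    proof -
      have "Y *v v = y"
        by (simp add: Y_def y_def matrix_vector_mult_def vec_eq_iff mat_def sum_subtractf algebra_simps
           if_distrib[of "\<lambda>x. _ * x"] if_distrib[of "\<lambda>x. x * _"] if_distrib[of "\<lambda>x. _ *\<^sub>R x"] cong: if_cong) (simp add: scaleR_conv_of_real)
      then show ?thesis by (simp add: sform_mult_vec)
    qed
    ultimately have "y = 0"
      by (simp add: qform_mat)
    then show ?thesis by (simp add: y_def)
  qed
  moreover have "v \<noteq> 0" using v by auto
  ultimately have "eigenvalue X (of_real m)" by (auto simp: eigenvalue_def)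
  then show ?thesis using lower that by blast
qed

text \<open>The lowest eigenvalue bounds the form from below; conversely the form at an eigenvector
  is the eigenvalue times the squared norm.\<close>

lemma psd_iff_qform: "psd X \<longleftrightarrow> (\<forall>v. qform X v \<in> \<real>\<^sub>\<ge>\<^sub>0)"
proof
  assume X: "psd X"
  then have h: "hermitian X" by (simp add: psd_def)
  obtain m where m: "eigenvalue X (of_real m)" "\<And>v. m * (norm v)\<^sup>2 \<le> Re (qform X v)"
    using qform_min_eigenvalue[OF h] by blast
  have "0 \<le> m" using X m(1) by (auto simp: psd_def complex_nonneg_Reals_iff)
  then have "0 \<le> Re (qform X v)" for v
    using m(2)[of v] by (smt (verit) mult_nonneg_nonneg zero_le_power2)
  then show "\<forall>v. qform X v \<in> \<real>\<^sub>\<ge>\<^sub>0"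
    using Im_qform_hermitian[OF h] by (simp add: complex_nonneg_Reals_iff)
next
  assume q: "\<forall>v. qform X v \<in> \<real>\<^sub>\<ge>\<^sub>0"
  have "hermitian X"
    using q by (intro hermitianI_qform) (simp add: complex_nonneg_Reals_iff)
  moreover have "c \<in> \<real>\<^sub>\<ge>\<^sub>0" if "eigenvalue X c" for c
  proof -
    obtain v where v: "v \<noteq> 0" "X *v v = c *s v"
      using \<open>eigenvalue X c\<close> by (auto simp: eigenvalue_def)
    have "qform X v = c * of_real ((norm v)\<^sup>2)"
      unfolding qform_mat[symmetric] sform_mult_vec v
      by (simp add: sum_distrib_left algebra_simps)
    then have "c * of_real ((norm v)\<^sup>2) \<in> \<real>\<^sub>\<ge>\<^sub>0" using q by metis
    moreover have "0 < (norm v)\<^sup>2" using v(1) by simp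
    ultimately show ?thesis
      by (simp add: complex_nonneg_Reals_iff zero_le_mult_iff del: of_real_power)
  qed
  ultimately show "psd X" by (simp add: psd_def)
qed

lemma psd_normalized:
  assumes "\<And>u. norm u = 1 \<Longrightarrow> qform X u \<in> \<real>\<^sub>\<ge>\<^sub>0"
  shows "psd X"
  unfolding psd_iff_qform
proof
  fix v
  show "qform X v \<in> \<real>\<^sub>\<ge>\<^sub>0"
  proof (cases "v = 0")
    case False
    have "qform X (of_real (1 / norm v) *s v) \<in> \<real>\<^sub>\<ge>\<^sub>0"
      using False by (intro assms) (simp add: norm_scale norm_divide)
    then show ?thesis using False
      by (simp add: sform_scale_left sform_scale_right complex_nonneg_Reals_iff
          zero_le_divide_iff mult_le_0_iff)
  qed simp
qed

lemma psd_iff: "psd X \<longleftrightarrow> (\<forall>v. 0 \<le> Re (qform X v) \<and> Im (qform X v) = 0)"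
  by (simp add: psd_iff_qform complex_nonneg_Reals_iff)

lemma psd_hermitian: "psd X \<Longrightarrow> hermitian X"
  by (simp add: psd_def)

lemma psd_add: "psd X \<Longrightarrow> psd Y \<Longrightarrow> psd (X + Y)"
  by (simp add: psd_iff sform_add_op)

lemma psd_scaleR: "psd X \<Longrightarrow> 0 \<le> r \<Longrightarrow> psd (r *\<^sub>R X)"
  by (simp add: psd_iff sform_scaleR_op)

lemma psd_zero [simp]: "psd 0"
  by (simp add: psd_iff)

lemma qform_outer: "qform (outer u) v = of_real ((norm (\<Sum>i\<in>UNIV. cnj (v $ i) * u $ i))\<^sup>2)"
proof -
  have "qform (outer u) v = (\<Sum>i\<in>UNIV. cnj (v $ i) * u $ i) * cnj (\<Sum>i\<in>UNIV. cnj (v $ i) * u $ i)"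
    by (simp add: sform_def outer_def sum_product mult_ac)
  then show ?thesis by (simp add: complex_norm_square del: of_real_power)
qed

lemma psd_outer: "psd (outer u)"
  by (simp add: psd_iff qform_outer del: of_real_power)

lemma trace_outer: "trace (outer u) = of_real ((norm u)\<^sup>2)"
  using qform_mat[of u] by (simp add: sform_mat trace_def outer_def mult.commute)

lemma state_outer: "norm u = 1 \<Longrightarrow> state (outer u)"
  by (simp add: state_def psd_outer trace_outer)

lemma hs_inner_outer: "hs_inner X (outer u) = cnj (qform X u)"
  by (simp add: hs_inner_eq_sum sform_def outer_def mult_ac)

lemma Re_hs_inner: "Re (hs_inner X Y) = inner X Y"
  by (simp add: hs_inner_eq_sum inner_vec_def inner_complex_def)

lemma dagger_mult: "dagger (X ** Y) = dagger Y ** dagger X"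
  by (simp add: dagger_def matrix_matrix_mult_def vec_eq_iff mult.commute)

lemma hs_inner_self: "hs_inner X X = of_real ((norm X)\<^sup>2)"
proof -
  have "Im (hs_inner X X) = 0" by (simp add: hs_inner_eq_sum)
  moreover have "Re (hs_inner X X) = (norm X)\<^sup>2"
    by (simp add: Re_hs_inner power2_norm_eq_inner)
  ultimately show ?thesis by (simp add: complex_eq_iff)
qed

section \<open>Unitaries, absolute values and the trace norm\<close>

definition unitary :: "'n::finite op \<Rightarrow> bool" where
  "unitary U \<longleftrightarrow> dagger U ** U = mat 1"

lemma unitary_mult: "unitary U \<Longrightarrow> unitary V \<Longrightarrow> unitary (U ** V)"
  unfolding unitary_def dagger_mult
  by (metis matrix_mul_assoc matrix_mul_lid)

lemma compact_unitary: "compact {U :: 'n::finite op. unitary U}"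
proof -
  have "(norm U)\<^sup>2 = real CARD('n)" if "unitary U" for U :: "'n op"
  proof -
    have "complex_of_real ((norm U)\<^sup>2) = of_real (real CARD('n))"
      using that unfolding hs_inner_self[symmetric] hs_inner_def unitary_def
      by (simp add: trace_def mat_def)
    then show ?thesis using of_real_eq_iff by blast
  qed
  then have "bounded {U :: 'n op. unitary U}"
    unfolding bounded_iff by (intro exI[of _ "sqrt (real CARD('n))"])
      (auto intro: real_le_rsqrt)
  moreover have "closed {U :: 'n op. unitary U}"
    unfolding unitary_def
    by (simp add: vec_eq_iff dagger_def matrix_matrix_mult_def)
      (intro closed_Collect_all closed_Collect_eq continuous_intros continuous_on_component)
  ultimately show ?thesis by (simp add: compact_eq_bounded_closed)
qed

lemma op_mult_add_left: "(A + B) ** C = A ** C + B ** C"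
  and op_mult_diff_left: "(A - B) ** C = A ** C - B ** C"
  and op_mult_diff_right: "A ** (B - C) = A ** B - A ** C"
  and op_mult_scale_left: "scale_op c A ** B = scale_op c (A ** B)"
  for A B C :: "'n::finite op"
  by (simp_all add: vec_eq_iff matrix_matrix_mult_def scale_op_def algebra_simps sum.distrib
      sum_subtractf sum_distrib_left)

lemma trace_scale: "trace (scale_op c X) = c * trace X"
  by (simp add: trace_def scale_op_def sum_distrib_left)

lemma trace_outer_mult: "trace (outer u ** X) = qform X u"
  by (simp add: trace_def outer_def matrix_matrix_mult_def sform_def mult_ac)
    (rule sum.swap)

text \<open>The operator multiplies \<open>u\<close> by \<open>c\<close> and fixes its orthogonal
  complement. With \<open>d = c - 1\<close>, unimodularity of \<open>c\<close> reads
  \<open>d + cnj d + cnj d * d = 0\<close>, which is the coefficient left over in the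
  product.\<close>

lemma unitary_phase:
  assumes "norm u = 1" "norm c = 1"
  shows "unitary (mat 1 + scale_op (c - 1) (outer u))"
proof -
  have u: "(\<Sum>i\<in>UNIV. u $ i * cnj (u $ i)) = 1"
    using qform_mat[of u] assms by (simp add: sform_mat mult.commute)
  define d where "d = c - 1"
  have "c * cnj c = 1" using assms(2) complex_norm_square[of c] by simp
  then have d: "d + cnj d + cnj d * d = 0" by (simp add: d_def algebra_simps)
  have "(\<Sum>k\<in>UNIV. cnj ((mat 1 + scale_op d (outer u)) $ k $ i)
        * (mat 1 + scale_op d (outer u)) $ k $ j)
      = (if i = j then 1 else 0)" (is "?l = _") for i j
  proof -
    have "?l = (\<Sum>k\<in>UNIV. (if k = i then (if k = j then 1 else 0) else 0)
       + (if k = i then d * u $ k * cnj (u $ j) else 0)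
       + (if k = j then cnj d * cnj (u $ k) * u $ i else 0)
       + (cnj d * d * u $ i * cnj (u $ j)) * (u $ k * cnj (u $ k)))"
      by (intro sum.cong refl) (auto simp: mat_def scale_op_def outer_def algebra_simps)
    also have "\<dots> = (if i = j then 1 else 0) + u $ i * cnj (u $ j) * (d + cnj d + cnj d * d)"
      by (simp only: sum.distrib sum_distrib_left[symmetric] u) (simp add: algebra_simps)
    finally show ?thesis by (simp add: d)
  qed
  then show ?thesis
    unfolding unitary_def d_def[symmetric]
    by (simp add: vec_eq_iff dagger_def matrix_matrix_mult_def) (simp add: mat_def)
qed

text \<open>
  Polar decomposition by maximisation: if \<open>U\<close> maximises \<open>Re (trace (U ** X))\<close> over the unitaries,
  comparing with the unitaries that multiply one vector by a phase shows \<open>U ** X\<close> to be positive.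
\<close>

lemma ex_abs_op: "\<exists>P. psd P \<and> P ** P = dagger X ** X"
proof -
  have "mat 1 \<in> {U. unitary U}"
    by (simp add: unitary_def dagger_def mat_def vec_eq_iff matrix_matrix_mult_def
           if_distrib[of "\<lambda>x. _ * x"] if_distrib[of "\<lambda>x. x * _"] if_distrib[of cnj] cong: if_cong)
  moreover have "continuous_on {U. unitary U} (\<lambda>U. Re (trace (U ** X)))"
    unfolding trace_def matrix_matrix_mult_def
    by (simp) (intro continuous_intros continuous_on_component)
  ultimately obtain U where U: "unitary U"
    and max: "\<And>V. unitary V \<Longrightarrow> Re (trace (V ** X)) \<le> Re (trace (U ** X))"
    using continuous_attains_sup[OF compact_unitary, of "\<lambda>U. Re (trace (U ** X))"] by blast
  define P where "P = U ** X"
  have unit: "qform P u \<in> \<real>\<^sub>\<ge>\<^sub>0" if "norm u = 1" for u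
  proof (cases "qform P u = 0")
    case False
    define z where "z = qform P u"
    \<comment> \<open>This phase turns \<open>z\<close> into its modulus; maximality then yields
      \<open>cmod z <= Re z\<close>.\<close>
    define c where "c = cnj z / of_real (cmod z)"
    have c: "norm c = 1" "c * z = of_real (cmod z)"
      using False by (auto simp: c_def z_def norm_divide field_simps complex_norm_square[symmetric]
          power2_eq_square)
    have "unitary ((mat 1 + scale_op (c - 1) (outer u)) ** U)"
      using unitary_mult unitary_phase that c(1) U by blast
    then have "Re (trace ((mat 1 + scale_op (c - 1) (outer u)) ** P)) \<le> Re (trace P)"
      unfolding P_def matrix_mul_assoc by (rule max)
    also have "(mat 1 + scale_op (c - 1) (outer u)) ** P = P + scale_op (c - 1) (outer u ** P)"
      by (simp add: op_mult_add_left op_mult_scale_left)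
    also have "trace \<dots> = trace P + (c - 1) * z"
      by (simp add: trace_add trace_scale trace_outer_mult z_def)
    finally have "cmod z \<le> Re z"
      using c(2) by (simp add: left_diff_distrib)
    then have "Re z = cmod z" using complex_Re_le_cmod[of z] by linarith
    moreover from this have "Im z = 0" using cmod_power2[of z] by simp
    ultimately have "z = of_real (cmod z)" by (simp add: complex_eq_iff)
    moreover have "complex_of_real (cmod z) \<in> \<real>\<^sub>\<ge>\<^sub>0" by simp
    ultimately show ?thesis unfolding z_def[symmetric] by metis
  qed simp
  have "psd P" using unit by (rule psd_normalized)
  moreover have "P ** P = dagger X ** X"
  proof -
    have "P ** P = dagger P ** P"
      using psd_hermitian[OF \<open>psd P\<close>] by (simp add: hermitian_def)
    also have "\<dots> = dagger X ** (dagger U ** U) ** X"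
      by (simp add: P_def dagger_mult matrix_mul_assoc)
    finally show ?thesis using U by (simp add: unitary_def)
  qed
  ultimately show ?thesis by blast
qed

lemma sform_mult_hermitian:
  assumes "hermitian P"
  shows "sform (P ** Q) v w = (\<Sum>i\<in>UNIV. cnj ((P *v v) $ i) * (Q *v w) $ i)"
proof -
  have "cnj (P $ i $ j) = P $ j $ i" for i j using assms by (simp add: hermitian_iff)
  then have "(\<Sum>i\<in>UNIV. cnj ((P *v v) $ i) * (Q *v w) $ i)
     = (\<Sum>k\<in>UNIV. \<Sum>i\<in>UNIV. cnj (v $ i) * P $ i $ k * (Q *v w) $ k)"
    by (simp add: matrix_vector_mult_def[of P] sum_distrib_left sum_distrib_right mult_ac)
  also have "\<dots> = (\<Sum>i\<in>UNIV. \<Sum>k\<in>UNIV. cnj (v $ i) * P $ i $ k * (Q *v w) $ k)"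
    by (rule sum.swap)
  also have "\<dots> = sform (P ** Q) v w"
    unfolding sform_mult_vec
    by (simp add: matrix_vector_mul_assoc[symmetric] matrix_vector_mult_def[of P] sum_distrib_left mult_ac)
  finally show ?thesis ..
qed

text \<open>Only eigenvalues of the difference are examined: once they all vanish, \<open>D\<close>
  and \<open>- D\<close> are both positive, so the form of \<open>D\<close> is zero.\<close>

lemma psd_square_unique:
  assumes P: "psd P" and Q: "psd Q" and eq: "P ** P = Q ** Q"
  shows "P = Q"
proof -
  define D where "D = P - Q"
  note h = psd_hermitian[OF P] psd_hermitian[OF Q]
  have hD: "hermitian D"
    using h by (simp add: D_def hermitian_iff)
  have zero: "c = 0" if ev: "eigenvalue D c" for c
  proof -
    obtain v where v: "v \<noteq> 0" "D *v v = c *s v"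
      using ev by (auto simp: eigenvalue_def)
    have Dv: "D *v v = P *v v - Q *v v"
      by (simp add: D_def matrix_vector_mult_diff_rdistrib)
    have n: "qform D v = c * of_real ((norm v)\<^sup>2)"
      unfolding qform_mat[symmetric] sform_mult_vec v
      by (simp add: sum_distrib_left algebra_simps)
    \<comment> \<open>\<open>P\<^sup>2 - Q\<^sup>2 = P D + D Q\<close> turns an eigenvector of \<open>D\<close> into a common zero of both forms.\<close>
    have "P ** D + D ** Q = 0"
      using eq by (simp add: D_def op_mult_diff_left op_mult_diff_right)
    then have "0 = sform (P ** D) v v + sform (D ** Q) v v"
      by (simp add: sform_add_op[symmetric])
    also have "\<dots> = c * qform P v + cnj c * qform Q v"
    proof -
      have "sform (P ** D) v v = cnj (\<Sum>i\<in>UNIV. cnj ((D *v v) $ i) * (P *v v) $ i)"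
        by (simp add: sform_mult_hermitian[OF h(1)] mult.commute)
      also have "\<dots> = c * cnj (qform P v)"
        unfolding v sform_mult_vec by (simp add: sum_distrib_left mult_ac)
      finally have 1: "sform (P ** D) v v = c * qform P v"
        by (simp add: sform_cnj[OF h(1)])
      have "sform (D ** Q) v v = cnj c * qform Q v"
        by (simp add: sform_mult_hermitian[OF hD] v)
          (simp add: sform_mult_vec sum_distrib_left mult_ac)
      then show ?thesis using 1 by simp
    qed
    finally have sum0: "c * qform P v + cnj c * qform Q v = 0" ..
    have real: "Im c = 0"
      using Im_qform_hermitian[OF hD, of v] v(1) by (simp add: n)
    then have "cnj c = c" by (simp add: complex_eq_iff)
    then have "c * (qform P v + qform Q v) = 0" using sum0 by (simp add: distrib_left)
    moreover have "c = 0" if "qform P v + qform Q v = 0"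
    proof -
      have "Re (qform P v) = 0" "Re (qform Q v) = 0" "Im (qform P v) = 0" "Im (qform Q v) = 0"
        using that P Q by (auto simp: psd_iff complex_eq_iff add_nonneg_eq_0_iff)
      then have "qform D v = 0" by (simp add: D_def sform_diff_op complex_eq_iff)
      then show ?thesis using n v(1) by simp
    qed
    ultimately show ?thesis by auto
  qed
  have zero_nonneg: "(0 :: complex) \<in> \<real>\<^sub>\<ge>\<^sub>0" by simp
  have "psd D" unfolding psd_def using zero hD zero_nonneg by metis
  moreover have "psd (- D)"
  proof -
    have "eigenvalue D (- c)" if c: "eigenvalue (- D) c" for c
    proof -
      obtain v where v: "v \<noteq> 0" "- D *v v = c *s v"
        using c by (auto simp: eigenvalue_def)
      have "(- D) *v v = - (D *v v)" by (simp add: matrix_vector_mult_def vec_eq_iff sum_negf)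
      then have "D *v v = - c *s v" using v(2)
        by (metis add.inverse_inverse vector_smult_lneg)
      then show ?thesis using v(1) by (auto simp: eigenvalue_def)
    qed
    moreover have "hermitian (- D)" using hD by (simp add: hermitian_iff)
    ultimately show ?thesis unfolding psd_def using zero zero_nonneg
      by (metis neg_equal_0_iff_equal)
  qed
  ultimately have "D = 0"
    by (intro sform_eq_zero_imp) (auto simp: psd_iff sform_minus_op complex_eq_iff intro!: antisym)
  then show ?thesis by (simp add: D_def)
qed

lemma abs_op: "psd (abs_op X)" "abs_op X ** abs_op X = dagger X ** X"
proof -
  have "\<exists>!P. psd P \<and> P ** P = dagger X ** X"
    using ex_abs_op[of X] psd_square_unique by metis
  from theI'[OF this] show "psd (abs_op X)" "abs_op X ** abs_op X = dagger X ** X"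
    unfolding abs_op_def by blast+
qed

lemma trace_norm_zero [simp]: "trace_norm (0 :: 'n::finite op) = 0"
proof -
  have "dagger 0 ** 0 = (0 :: 'n op)" "0 ** 0 = (0 :: 'n op)"
    by (simp_all add: vec_eq_iff matrix_matrix_mult_def)
  then have "abs_op 0 = (0 :: 'n op)"
    using abs_op[of "0 :: 'n op"] psd_zero psd_square_unique by metis
  then show ?thesis by (simp add: trace_norm_def trace_def)
qed

lemma psd_entry_bound:
  assumes P: "psd P"
  shows "(cmod (P $ i $ j))\<^sup>2 \<le> Re (P $ i $ i) * Re (P $ j $ j)"
proof -
  define a where "a = Re (P $ i $ i)"
  define b where "b = Re (P $ j $ j)"
  define z where "z = P $ i $ j"
  have h: "cnj (P $ k $ l) = P $ l $ k" for k l
    using psd_hermitian[OF P] by (simp add: hermitian_iff)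
  have pij: "P $ j $ i = cnj z" and im: "Im (P $ i $ i) = 0" "Im (P $ j $ j) = 0"
    using Im_qform_hermitian[OF psd_hermitian[OF P], of "axis i 1"]
      Im_qform_hermitian[OF psd_hermitian[OF P], of "axis j 1"]
    by (simp_all add: sform_axis z_def h)
  have ab: "0 \<le> a" "0 \<le> b"
    using P sform_axis[of P] unfolding psd_iff a_def b_def by metis+
  \<comment> \<open>The form at \<open>s e_i - t (cnj z) e_j\<close>; the phase of the second
    coefficient makes the mixed term real. The choice \<open>s = b\<close>, \<open>t = 1\<close>
    gives the determinant.\<close>
  have *: "0 \<le> s\<^sup>2 * a - 2 * s * t * (cmod z)\<^sup>2 + (cmod z)\<^sup>2 * t\<^sup>2 * b" for s t
  proof -
    have "0 \<le> Re (qform P (of_real s *s axis i 1 + (- of_real t * cnj z) *s axis j 1))"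
      using P by (simp add: psd_iff)
    also have "\<dots> = s\<^sup>2 * a - 2 * s * t * (cmod z)\<^sup>2 + (cmod z)\<^sup>2 * t\<^sup>2 * b"
      using im unfolding cmod_power2
      by (simp only: sform_add_left sform_add_right sform_scale_left sform_scale_right sform_axis pij z_def[symmetric])
        (simp add: a_def b_def power2_eq_square algebra_simps)
    finally show ?thesis .
  qed
  show ?thesis
  proof (cases "b = 0")
    case True
    have "0 \<le> t * (- 2 * (cmod z)\<^sup>2) + t\<^sup>2 * 0 + a" for t using *[of 1 t] True by simp
    have "(cmod z)\<^sup>2 = 0"
    proof (rule ccontr)
      assume "(cmod z)\<^sup>2 \<noteq> 0"
      \<comment> \<open>With \<open>b = 0\<close> the expression is affine in \<open>t\<close>, and
        here it equals -1.\<close>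
      then show False using *[of 1 "(a + 1) / (2 * (cmod z)\<^sup>2)"] True by (simp add: field_simps)
    qed
    then show ?thesis by (simp add: z_def[symmetric] a_def[symmetric] b_def[symmetric] True)
  next
    case False
    have "0 \<le> b * (a * b - (cmod z)\<^sup>2)"
      using *[of b 1] by (simp add: power2_eq_square algebra_simps)
    then have "(cmod z)\<^sup>2 \<le> a * b" using ab False by (simp add: zero_le_mult_iff)
    then show ?thesis by (simp add: z_def a_def b_def)
  qed
qed

lemma norm_le_trace:
  assumes P: "psd P"
  shows "norm P \<le> Re (trace P)"
proof -
  have diag: "0 \<le> Re (P $ i $ i)" for i
    using P sform_axis[of P] unfolding psd_iff by metis
  have "(norm P)\<^sup>2 = (\<Sum>i\<in>UNIV. \<Sum>j\<in>UNIV. (cmod (P $ i $ j))\<^sup>2)"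
    by (simp add: norm_vec_def L2_set_def sum_nonneg)
  also have "\<dots> \<le> (\<Sum>i\<in>UNIV. \<Sum>j\<in>UNIV. Re (P $ i $ i) * Re (P $ j $ j))"
    by (intro sum_mono psd_entry_bound P)
  also have "\<dots> = (Re (trace P))\<^sup>2"
    by (simp add: trace_def sum_product power2_eq_square)
  finally show ?thesis
    using diag by (simp add: power2_le_iff_abs_le trace_def sum_nonneg)
qed

text \<open>\<open>X\<close> and its absolute value have the same Euclidean norm because
  \<open>P ** P = dagger X ** X\<close>. Hence approximation in trace norm is approximation in the
  Euclidean topology.\<close>

lemma norm_le_trace_norm: "norm X \<le> trace_norm X"
proof -
  define P where "P = abs_op X"
  note P = abs_op[of X, folded P_def]
  have "complex_of_real ((norm X)\<^sup>2) = of_real ((norm P)\<^sup>2)"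
    using P psd_hermitian[OF P(1)] unfolding hs_inner_self[symmetric] hs_inner_def hermitian_def
    by simp
  then have "(norm X)\<^sup>2 = (norm P)\<^sup>2" using of_real_eq_iff by blast
  then have "norm X = norm P" by simp
  then show ?thesis using norm_le_trace[OF P(1)] by (simp add: trace_norm_def P_def)
qed

subsection \<open>Maps on Hermitian matrices that preserve positivity\<close>

lemma quadratic_nonneg_discriminant:
  fixes a b c :: real
  assumes "0 \<le> c" and nonneg: "\<And>t. 0 \<le> a + 2 * t * b + t\<^sup>2 * c"
  shows "b\<^sup>2 \<le> a * c"
proof (cases "c = 0")
  case True
  have "b = 0"
  proof (rule ccontr)
    assume "b \<noteq> 0"
    then show False using nonneg[of "- (a + 1) / (2 * b)"] True by (simp add: field_simps)
  qed
  then show ?thesis using True by simp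
next
  case False
  then have c: "0 < c" using assms by simp
  have "0 \<le> c * (a + 2 * (- b / c) * b + (- b / c)\<^sup>2 * c)"
    using nonneg[of "- b / c"] c by simp
  also have "\<dots> = a * c - b\<^sup>2" using c by (simp add: field_simps power2_eq_square)
  finally show ?thesis by simp
qed

lemma bilinear_add_scale:
  fixes t :: real
  assumes "bilinear f" "\<And>x y. f x y = f y x"
  shows "f (x + t *\<^sub>R y) (x + t *\<^sub>R y) = f x x + 2 * t * f x y + t\<^sup>2 * f y y"
proof -
  have "f (x + t *\<^sub>R y) (x + t *\<^sub>R y) = f x x + t * f x y + t * f y x + t * (t * f y y)"
    using assms(1) by (simp add: bilinear_ladd bilinear_radd bilinear_lmul bilinear_rmul algebra_simps)
  then show ?thesis using assms(2)[of y x] by (simp add: power2_eq_square)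
qed

lemma bilinear_Cauchy_Schwarz:
  fixes f :: "'a::real_vector \<Rightarrow> 'a \<Rightarrow> real"
  assumes "bilinear f" "\<And>x y. f x y = f y x" "\<And>x. 0 \<le> f x x"
  shows "(f x y)\<^sup>2 \<le> f x x * f y y"
proof (rule quadratic_nonneg_discriminant[OF assms(3)])
  show "0 \<le> f x x + 2 * t * f x y + t\<^sup>2 * f y y" for t
    using assms(3)[of "x + t *\<^sub>R y"] bilinear_add_scale[OF assms(1,2), of x t y] by simp
qed

text \<open>It suffices that the ratio \<open>f / g\<close> at any point with \<open>g < 0\<close>
  is at most the ratio at any point with \<open>g > 0\<close>. The line through two such points
  meets \<open>g = 0\<close> on both sides of \<open>x\<close>, and there \<open>f\<close> is
  nonnegative.\<close>

lemma S_lemma: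
  fixes f g :: "'a::real_vector \<Rightarrow> 'a \<Rightarrow> real"
  assumes f: "bilinear f" "\<And>x y. f x y = f y x"
    and g: "bilinear g" "\<And>x y. g x y = g y x"
    and nonneg: "\<And>x. g x x = 0 \<Longrightarrow> 0 \<le> f x x"
    and "g x0 x0 < 0" "0 < g y0 y0"
  obtains m where "\<And>x. m * g x x \<le> f x x"
proof -
  have key: "f x x / g x x \<le> f y y / g y y" if "g x x < 0" "0 < g y y" for x y
  proof -
    define a b c where "a = g y y" and "b = g x y" and "c = g x x"
    have ac: "0 < a" "c < 0" using that by (auto simp: a_def c_def)
    define s where "s = sqrt (b\<^sup>2 - a * c)"
    have "a * c < 0" using ac by (simp add: mult_pos_neg)
    then have "\<bar>b\<bar> < s" unfolding s_def by (intro real_less_rsqrt) simp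
    have s2: "s\<^sup>2 = b\<^sup>2 - a * c" using \<open>a * c < 0\<close> zero_le_power2[of b] unfolding s_def
      by (intro real_sqrt_pow2) linarith
    define t1 t2 where "t1 = (- b - s) / a" and "t2 = (- b + s) / a"
    have t: "t1 < 0" "0 < t2" using \<open>\<bar>b\<bar> < s\<close> ac by (auto simp: t1_def t2_def divide_less_0_iff)
    have "t1 * t2 = (b\<^sup>2 - s\<^sup>2) / a\<^sup>2"
      using ac by (simp add: t1_def t2_def field_simps power2_eq_square)
    then have t12: "t1 * t2 = c / a"
      using ac unfolding s2 by (simp add: power2_eq_square)
    have "c + 2 * t1 * b + t1\<^sup>2 * a = (a * c - b\<^sup>2 + s\<^sup>2) / a"
      "c + 2 * t2 * b + t2\<^sup>2 * a = (a * c - b\<^sup>2 + s\<^sup>2) / a"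
      using ac by (simp_all add: t1_def t2_def field_simps power2_eq_square)
    then have "c + 2 * t1 * b + t1\<^sup>2 * a = 0" "c + 2 * t2 * b + t2\<^sup>2 * a = 0"
      by (simp_all add: s2)
    then have root: "0 \<le> f x x + 2 * t1 * f x y + t1\<^sup>2 * f y y" "0 \<le> f x x + 2 * t2 * f x y + t2\<^sup>2 * f y y"
      using nonneg[of "x + t1 *\<^sub>R y"] nonneg[of "x + t2 *\<^sub>R y"]
      by (simp_all add: bilinear_add_scale[OF f] bilinear_add_scale[OF g] a_def b_def c_def)
    \<comment> \<open>The positive weights \<open>t2\<close> and \<open>- t1\<close> cancel the
      mixed term \<open>f x y\<close>.\<close>
    have "0 \<le> t2 * (f x x + 2 * t1 * f x y + t1\<^sup>2 * f y y) + (- t1) * (f x x + 2 * t2 * f x y + t2\<^sup>2 * f y y)"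
      using t root mult_nonneg_nonneg[OF _ root(1), of t2] mult_nonneg_nonneg[OF _ root(2), of "- t1"]
      by linarith
    also have "\<dots> = (t2 - t1) * (f x x - t1 * t2 * f y y)"
      by (simp add: algebra_simps power2_eq_square)
    finally have "0 \<le> f x x - c / a * f y y" using t by (simp add: zero_le_mult_iff t12)
    then have "f x x / c \<le> (c / a * f y y) / c" using ac by (intro divide_right_mono_neg) auto
    then show ?thesis using ac by (simp add: a_def c_def)
  qed
  \<comment> \<open>Any number between the two families of ratios would serve as \<open>m\<close>;
    the infimum of the upper family is one. The point \<open>y0\<close> makes \<open>S\<close>
    nonempty and \<open>x0\<close> bounds it below.\<close>
  define S where "S = {f y y / g y y |y. 0 < g y y}"
  have ne: "S \<noteq> {}" using assms(7) by (auto simp: S_def)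
  have "bdd_below S"
    using key[OF assms(6)] by (intro bdd_belowI[of _ "f x0 x0 / g x0 x0"]) (auto simp: S_def)
  have "Inf S * g x x \<le> f x x" for x
  proof (cases "g x x" "0 :: real" rule: linorder_cases)
    case less
    have "f x x / g x x \<le> Inf S"
      using key[OF less] by (intro cInf_greatest ne) (auto simp: S_def)
    then show ?thesis using less by (simp add: neg_divide_le_eq)
  next
    case equal
    then show ?thesis using nonneg by simp
  next
    case greater
    have "Inf S \<le> f x x / g x x"
      using greater by (intro cInf_lower \<open>bdd_below S\<close>) (auto simp: S_def)
    then show ?thesis using greater by (simp add: field_simps)
  qed
  then show ?thesis by (rule that)
qed

text \<open>
  The triple \<open>(a, b, z)\<close> stands for the Hermitian matrix with rows \<open>(a, z)\<close> and \<open>(cnj z, b)\<close>;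
  \<open>dform\<close> is the polarisation of its determinant and \<open>ketbra y\<close> is the matrix \<open>y y\<^sup>*\<close>.
\<close>

type_synonym herm2 = "real \<times> real \<times> complex"

definition dform :: "herm2 \<Rightarrow> herm2 \<Rightarrow> real" where
  "dform X Y = (fst X * fst (snd Y) + fst (snd X) * fst Y) / 2 - inner (snd (snd X)) (snd (snd Y))"

text \<open>The Gram operator of \<open>dform\<close> for the standard inner product; it turns the
  functionals \<open>dform _ Y\<close> into vectors, so that \<open>adjoint\<close> can be applied
  to them.\<close>

definition dflip :: "herm2 \<Rightarrow> herm2" where
  "dflip Y = (fst (snd Y) / 2, fst Y / 2, - snd (snd Y))"

lemma inner_dflip: "inner X (dflip Y) = dform X Y"
  by (simp add: dflip_def dform_def inner_prod_def field_simps)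

lemma linear_dflip: "linear dflip"
  by (rule linearI) (simp_all add: dflip_def prod_eq_iff field_simps)

lemma dform_commute: "dform X Y = dform Y X"
  by (simp add: dform_def inner_commute algebra_simps)

lemma bilinear_dform: "bilinear dform"
  unfolding bilinear_def
  by (intro conjI allI linearI) (simp_all add: dform_def inner_add_left inner_add_right field_simps)

definition hpos :: "herm2 \<Rightarrow> bool" where
  "hpos X \<longleftrightarrow> 0 \<le> fst X \<and> 0 \<le> fst (snd X) \<and> 0 \<le> dform X X"

text \<open>The quadratic form \<open>x* X x\<close> of the encoded matrix.\<close>

definition hval :: "herm2 \<Rightarrow> complex^2 \<Rightarrow> real" where
  "hval X x = fst X * (cmod (x $ 1))\<^sup>2 + fst (snd X) * (cmod (x $ 2))\<^sup>2
    + 2 * Re (cnj (x $ 1) * snd (snd X) * x $ 2)"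

definition ketbra :: "complex^2 \<Rightarrow> herm2" where
  "ketbra y = ((cmod (y $ 1))\<^sup>2, (cmod (y $ 2))\<^sup>2, y $ 1 * cnj (y $ 2))"

lemma dform_self: "dform X X = fst X * fst (snd X) - (cmod (snd (snd X)))\<^sup>2"
  by (simp add: dform_def power2_norm_eq_inner)

lemma dform_ketbra [simp]: "dform (ketbra y) (ketbra y) = 0"
  by (simp add: dform_self ketbra_def norm_mult power_mult_distrib)

lemma phase: obtains w where "cmod w = 1" "z = of_real (cmod z) * w"
proof (cases "z = 0")
  case True
  then show ?thesis using that[of 1] by simp
next
  case False
  then show ?thesis using that[of "z / of_real (cmod z)"] by (simp add: norm_divide)
qed

text \<open>A nonnegative determinant bounds the form below by the square of
  \<open>sqrt a * cmod (x $ 1) - sqrt b * cmod (x $ 2)\<close>. Conversely, at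
  \<open>(1, t * cnj w)\<close> with \<open>w\<close> the phase of \<open>z\<close>, the form is a
  real quadratic in \<open>t\<close>, whose discriminant is the determinant up to sign and
  factor.\<close>

lemma hpos_iff_hval: "hpos X \<longleftrightarrow> (\<forall>x. 0 \<le> hval X x)"
proof
  assume X: "hpos X"
  obtain a b z where abz: "X = (a, b, z)" by (cases X) auto
  have ab: "0 \<le> a" "0 \<le> b" "(cmod z)\<^sup>2 \<le> a * b"
    using X by (auto simp: hpos_def dform_self abz)
  have "cmod z \<le> sqrt a * sqrt b"
    using real_le_rsqrt[OF ab(3)] by (simp add: real_sqrt_mult)
  show "\<forall>x. 0 \<le> hval X x"
  proof
    fix x :: "complex^2"
    let ?x = "cmod (x $ 1)" and ?y = "cmod (x $ 2)"
    have "- Re (cnj (x $ 1) * z * x $ 2) \<le> cmod (cnj (x $ 1) * z * x $ 2)"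
      using complex_Re_le_cmod[of "- (cnj (x $ 1) * z * x $ 2)"] by simp
    also have "\<dots> = cmod z * (?x * ?y)" by (simp add: norm_mult)
    also have "\<dots> \<le> (sqrt a * sqrt b) * (?x * ?y)"
      by (intro mult_right_mono) (use \<open>cmod z \<le> sqrt a * sqrt b\<close> in auto)
    finally have 1: "- Re (cnj (x $ 1) * z * x $ 2) \<le> (sqrt a * ?x) * (sqrt b * ?y)"
      by (simp add: mult_ac)
    have "0 \<le> (sqrt a * ?x - sqrt b * ?y)\<^sup>2" by simp
    also have "\<dots> = a * ?x\<^sup>2 + b * ?y\<^sup>2 - 2 * ((sqrt a * ?x) * (sqrt b * ?y))"
      using ab by (simp add: power2_diff power_mult_distrib)
    finally show "0 \<le> hval X x" using 1 by (simp add: hval_def abz)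
  qed
next
  assume v: "\<forall>x. 0 \<le> hval X x"
  obtain a b z where abz: "X = (a, b, z)" by (cases X) auto
  have *: "0 \<le> a * (cmod s)\<^sup>2 + b * (cmod t)\<^sup>2 + 2 * Re (cnj s * z * t)" for s t
    using v[THEN spec, of "vector [s, t]"] by (simp add: hval_def abz)
  have ab: "0 \<le> a" "0 \<le> b" using *[of 1 0] *[of 0 1] by auto
  obtain w where w: "cmod w = 1" "z = of_real (cmod z) * w" by (rule phase)
  have "(cmod z)\<^sup>2 \<le> a * b"
  proof (rule quadratic_nonneg_discriminant[OF ab(2)])
    fix t
    have "z * cnj w = of_real (cmod z)"
      using w(1) complex_norm_square[of w] by (subst w(2)) (simp add: mult.assoc)
    then have "z * (of_real t * cnj w) = of_real (t * cmod z)"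
      by (simp only: mult.left_commute[of z] of_real_mult)
    then have "Re (z * (of_real t * cnj w)) = t * cmod z"
      by (metis Re_complex_of_real)
    then show "0 \<le> a + 2 * t * cmod z + t\<^sup>2 * b"
      using *[of 1 "of_real t * cnj w"] w(1) by (simp add: norm_mult power_mult_distrib mult_ac)
  qed
  then show "hpos X" using ab by (simp add: hpos_def dform_self abz)
qed

lemma hval_ketbra: "hval (ketbra u) x = (cmod (cnj (u $ 1) * x $ 1 + cnj (u $ 2) * x $ 2))\<^sup>2"
  unfolding hval_def ketbra_def cmod_power2
  by (simp add: power2_eq_square algebra_simps)

lemma dform_null_cases:
  assumes "dform X X = 0"
  obtains y where "X = ketbra y" | y where "X = - ketbra y"
proof -
  obtain a b z where abz: "X = (a, b, z)" by (cases X) auto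
  have ab: "a * b = (cmod z)\<^sup>2" using assms by (simp add: dform_self abz)
  \<comment> \<open>The witness is the first column of the matrix divided by
    \<open>sqrt a\<close>.\<close>
  have pos: "\<exists>y. (a, b, z) = ketbra y" if "0 < a" "a * b = (cmod z)\<^sup>2" for a b z
    using that
    by (intro exI[of _ "vector [of_real (sqrt a), cnj z / of_real (sqrt a)]"])
      (simp add: ketbra_def norm_divide power_divide field_simps)
  show ?thesis
  proof (cases a "0 :: real" rule: linorder_cases)
    case greater
    then show ?thesis using pos[OF greater ab] that(1) abz by blast
  next
    case less
    then obtain y where "(- a, - b, - z) = ketbra y" using pos[of "- a" "- b" "- z"] ab by auto
    then have "X = - ketbra y" by (simp add: abz flip: \<open>_ = ketbra y\<close>)
    then show ?thesis by (rule that(2))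
  next
    case equal
    then have z: "z = 0" using ab by simp
    show ?thesis
    proof (cases "0 \<le> b")
      case True
      then show ?thesis using that(1)[of "vector [0, of_real (sqrt b)]"]
        by (simp add: ketbra_def abz equal z)
    next
      case False
      then show ?thesis using that(2)[of "vector [0, of_real (sqrt (- b))]"]
        by (simp add: ketbra_def abz equal z)
    qed
  qed
qed

lemma hpos_null:
  assumes "hpos X" "dform X X = 0"
  obtains y where "X = ketbra y"
  using dform_null_cases[OF assms(2)]
proof cases
  case (2 y)
  then have "y $ 1 = 0" "y $ 2 = 0" using assms(1) by (auto simp: hpos_def ketbra_def)
  then show ?thesis using 2 that[of 0] by (simp add: ketbra_def)
qed (use that in auto)

text \<open>A nonnegative determinant forces the diagonal entries to share a sign, which the trace
  then decides.\<close>

lemma hpos_iff_trace: "hpos X \<longleftrightarrow> 0 \<le> dform X X \<and> 0 \<le> fst X + fst (snd X)"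
proof
  assume *: "0 \<le> dform X X \<and> 0 \<le> fst X + fst (snd X)"
  then have "0 \<le> fst X * fst (snd X)"
    unfolding dform_self using zero_le_power2[of "cmod (snd (snd X))"] by linarith
  then show "hpos X" using * unfolding hpos_def zero_le_mult_iff by auto
qed (auto simp: hpos_def)

text \<open>Positivity could only be lost through a change of sign of the trace, but a traceless
  Hermitian 2 x 2 matrix has determinant at most zero.\<close>

lemma hpos_segment:
  assumes "hpos P" and pos: "\<And>s. \<bar>s\<bar> \<le> r \<Longrightarrow> 0 < dform (P + s *\<^sub>R N) (P + s *\<^sub>R N)"
    and "\<bar>s\<bar> \<le> r"
  shows "hpos (P + s *\<^sub>R N)"
proof (rule ccontr)
  assume "\<not> hpos (P + s *\<^sub>R N)"
  define p n where "p = fst P + fst (snd P)" and "n = fst N + fst (snd N)"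
  have p: "0 \<le> p" using assms(1) by (simp add: hpos_def p_def)
  have neg: "p + s * n < 0"
    using \<open>\<not> hpos _\<close> less_imp_le[OF pos[OF assms(3)]]
    unfolding hpos_iff_trace by (simp add: p_def n_def algebra_simps)
  \<comment> \<open>The parameter at which the trace vanishes; it lies between 0 and
    \<open>s\<close>.\<close>
  define t where "t = - p / n"
  have n: "n \<noteq> 0" using p neg by auto
  have "\<bar>t\<bar> \<le> \<bar>s\<bar>"
  proof -
    have "\<bar>p\<bar> \<le> \<bar>s\<bar> * \<bar>n\<bar>" using p neg by (simp add: abs_mult[symmetric])
    then show ?thesis using n by (simp add: t_def field_simps)
  qed
  then have "0 < dform (P + t *\<^sub>R N) (P + t *\<^sub>R N)" using assms(3) by (intro pos) simp
  moreover have "fst (P + t *\<^sub>R N) = - fst (snd (P + t *\<^sub>R N))"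
    using n by (simp add: t_def p_def n_def field_simps)
  ultimately show False
    unfolding dform_self by (smt (verit) zero_le_power2 mult_minus_left power2_eq_square)
qed

text \<open>On a singular \<open>X\<close> the determinant of the perturbed value is
  \<open>B X X\<close> plus a term linear and a term quadratic in \<open>s\<close>. The choice of
  \<open>u\<close> and \<open>v\<close> bounds both by small multiples of \<open>B X X\<close>
  itself, so one radius \<open>r\<close> serves all \<open>y\<close>.\<close>

lemma perturbation:
  fixes F :: "herm2 \<Rightarrow> herm2"
  assumes F: "linear F" and pos: "\<And>y. hpos (F (ketbra y))"
  obtains (conformal) m where "\<And>X. dform (F X) (F X) = m * dform X X"
  | (perturb) u v r where "u \<noteq> 0" "v \<noteq> 0" "0 < r"
      "\<And>s y. \<bar>s\<bar> \<le> r \<Longrightarrow> hpos (F (ketbra y) + s *\<^sub>R inner v (ketbra y) *\<^sub>R u)"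
proof -
  have bil: "bilinear (\<lambda>X Y. dform (F X) (F Y))"
    unfolding bilinear_def
    by (intro conjI allI linearI)
      (simp_all add: linear_add[OF F] linear_cmul[OF F]
        bilinear_ladd[OF bilinear_dform] bilinear_radd[OF bilinear_dform]
        bilinear_lmul[OF bilinear_dform] bilinear_rmul[OF bilinear_dform])
  have "0 \<le> dform (F X) (F X)" if null: "dform X X = 0" for X
    using dform_null_cases[OF null]
  proof cases
    case (1 y)
    then show ?thesis using pos[of y] by (simp add: hpos_def)
  next
    case (2 y)
    then have "dform (F X) (F X) = dform (F (ketbra y)) (F (ketbra y))"
      by (simp add: linear_neg[OF F] bilinear_lneg[OF bilinear_dform] bilinear_rneg[OF bilinear_dform])
    then show ?thesis using pos[of y] by (simp add: hpos_def)
  qed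
  moreover have "dform (1, - 1, 0) (1, - 1, 0) < 0" "0 < dform (1, 1, 0) (1, 1, 0)"
    by (simp_all add: dform_self)
  ultimately obtain m where m: "\<And>X. m * dform X X \<le> dform (F X) (F X)"
    using S_lemma[OF bil dform_commute bilinear_dform dform_commute] by metis
  define B where "B X Y = dform (F X) (F Y) - m * dform X Y" for X Y
  have B: "bilinear B" "\<And>X Y. B X Y = B Y X" "\<And>X. 0 \<le> B X X"
  proof -
    show "bilinear B"
      unfolding bilinear_def B_def
      by (intro conjI allI linearI)
        (simp_all add: bilinear_ladd[OF bil] bilinear_radd[OF bil] bilinear_lmul[OF bil] bilinear_rmul[OF bil]
          bilinear_ladd[OF bilinear_dform] bilinear_radd[OF bilinear_dform]
          bilinear_lmul[OF bilinear_dform] bilinear_rmul[OF bilinear_dform] algebra_simps)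
  qed (use m in \<open>simp_all add: B_def dform_commute\<close>)
  show ?thesis
  proof (cases "\<exists>w. B w w \<noteq> 0")
    case False
    then have "B X X = 0" for X by blast
    then show ?thesis using conformal[of m] unfolding B_def by (metis eq_iff_diff_eq_0)
  next
    case True
    then obtain w where w: "0 < B w w" using B(3) by (metis less_eq_real_def)
    define C where "C = B w w"
    \<comment> \<open>The vector representing the functional \<open>B _ w\<close>.\<close>
    define v where "v = adjoint F (dflip (F w)) - m *\<^sub>R dflip w"
    have v: "inner v X = B X w" for X
      using adjoint_works[OF F, of X "dflip (F w)"]
      by (simp add: v_def B_def inner_diff_left inner_diff_right inner_commute[of _ X] inner_dflip)
    have "v \<noteq> 0" using v[of w] w by auto
    have v2: "(inner v X)\<^sup>2 \<le> C * B X X" for X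
      using bilinear_Cauchy_Schwarz[OF B, of X w] by (simp add: v C_def mult.commute)
    define L where "L u = adjoint F (dflip u)" for u
    have L: "inner (L u) X = dform (F X) u" for u X
      using adjoint_works[OF F, of X "dflip u"] by (simp add: L_def inner_commute[of _ X] inner_dflip)
    have linL: "linear L"
      using linear_compose[OF linear_dflip adjoint_linear[OF F]] by (simp add: L_def[abs_def] o_def)
    \<comment> \<open>Either some \<open>u\<close> kills the mixed term, or every functional, in particular \<open>v\<close>, is such a mixed term.\<close>
    have "\<exists>u. u \<noteq> 0 \<and> (\<forall>X. \<bar>dform (F X) u\<bar> * \<bar>inner v X\<bar> \<le> C * B X X)"
    proof (cases "inj L")
      case True
      then have "surj L" using linear_injective_imp_surjective[OF linL] by blast
      then obtain u where u: "L u = v" by (metis surj_def)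
      then have "u \<noteq> 0" using \<open>v \<noteq> 0\<close> linear_0[OF linL] by auto
      moreover have "\<bar>dform (F X) u\<bar> * \<bar>inner v X\<bar> \<le> C * B X X" for X
        using v2[of X] by (simp add: L[symmetric] u power2_eq_square abs_mult[symmetric])
      ultimately show ?thesis by blast
    next
      case False
      then obtain u where "L u = 0" "u \<noteq> 0" using linear_injective_0[OF linL] by blast
      moreover have "dform (F X) u = 0" for X using L[of u X] \<open>L u = 0\<close> by simp
      moreover have "0 \<le> C * B X X" for X using B(3) w by (simp add: C_def)
      ultimately show ?thesis by (intro exI[of _ u]) simp
    qed
    then obtain u where "u \<noteq> 0" and u: "\<And>X. \<bar>dform (F X) u\<bar> * \<bar>inner v X\<bar> \<le> C * B X X" by blast
    define d where "d = \<bar>dform u u\<bar>"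
    \<comment> \<open>The denominator is \<open>2 * (2 * C + C * d) + 2\<close>, so the two
      correction terms together cost at most half of \<open>B X X\<close>; the summand 2 also
      ensures \<open>r <= 1\<close>, whence \<open>s^2 <= r\<close>.\<close>
    define r where "r = 1 / (4 * C + 2 * C * d + 2)"
    have C: "0 < C" "0 \<le> C * d" using w by (simp_all add: C_def d_def)
    then have den: "0 < 4 * C + 2 * C * d + 2" by linarith
    have r: "0 < r" "r \<le> 1" "r * (2 * C + C * d) \<le> 1 / 2"
      using C den by (auto simp: r_def divide_simps)
    have det: "B X X / 2 \<le> dform (F X + s *\<^sub>R inner v X *\<^sub>R u) (F X + s *\<^sub>R inner v X *\<^sub>R u)"
      if s: "\<bar>s\<bar> \<le> r" and null: "dform X X = 0" for s X
    proof -
      let ?a = "s * inner v X * dform (F X) u" and ?b = "s\<^sup>2 * (inner v X)\<^sup>2 * dform u u"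
      have "\<bar>?a\<bar> = \<bar>s\<bar> * (\<bar>dform (F X) u\<bar> * \<bar>inner v X\<bar>)" by (simp add: abs_mult)
      also have "\<dots> \<le> r * (C * B X X)" by (rule mult_mono[OF s u]) (use r in auto)
      finally have a: "\<bar>?a\<bar> \<le> r * (C * B X X)" .
      have "s\<^sup>2 \<le> r * 1"
        using s r unfolding power2_eq_square abs_mult_self_eq[symmetric, of s]
        by (intro mult_mono) auto
      then have "\<bar>?b\<bar> \<le> r * (C * B X X) * d"
        unfolding abs_mult d_def[symmetric] using v2[of X] r C B(3)[of X]
        by (intro mult_mono) (auto simp: d_def)
      with a have "2 * \<bar>?a\<bar> + \<bar>?b\<bar> \<le> B X X * (r * (2 * C + C * d))"
        by (simp add: algebra_simps)
      also have "\<dots> \<le> B X X * (1 / 2)" using r(3) B(3) by (intro mult_left_mono) auto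
      finally have "B X X / 2 \<le> B X X + 2 * ?a + ?b" by linarith
      also have "\<dots> = dform (F X + (s * inner v X) *\<^sub>R u) (F X + (s * inner v X) *\<^sub>R u)"
        by (simp add: bilinear_add_scale[OF bilinear_dform dform_commute] B_def null power_mult_distrib mult_ac)
      finally show ?thesis by simp
    qed
    have "hpos (F (ketbra y) + s *\<^sub>R inner v (ketbra y) *\<^sub>R u)" if s: "\<bar>s\<bar> \<le> r" for s y
    proof (cases "B (ketbra y) (ketbra y) = 0")
      case True
      \<comment> \<open>Without slack the perturbation itself is zero at this
        \<open>y\<close>.\<close>
      then have "inner v (ketbra y) = 0" using v2[of "ketbra y"] by simp
      then show ?thesis using pos by simp
    next
      case False
      then have "0 < B (ketbra y) (ketbra y) / 2" using B(3)[of "ketbra y"] by simp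
      then have "0 < dform (F (ketbra y) + t *\<^sub>R inner v (ketbra y) *\<^sub>R u)
          (F (ketbra y) + t *\<^sub>R inner v (ketbra y) *\<^sub>R u)" if "\<bar>t\<bar> \<le> r" for t
        using det[OF that, of "ketbra y"] by simp
      then show ?thesis by (rule hpos_segment[OF pos _ s])
    qed
    then show ?thesis using perturb[OF \<open>u \<noteq> 0\<close> \<open>v \<noteq> 0\<close> r(1)] by blast
  qed
qed

subsection \<open>Block-positive two-qubit operators\<close>

lemma sum_UNIV_prod: "(\<Sum>p\<in>UNIV. f p) = (\<Sum>i\<in>UNIV. \<Sum>k\<in>UNIV. f (i, k))"
  for f :: "'a::finite \<times> 'b::finite \<Rightarrow> 'c::comm_monoid_add"
  by (simp add: sum.cartesian_product)

lemma op_2x2_eqI: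
  fixes A B :: "(2 \<times> 2) op"
  assumes "\<And>i k j l. A $ (i, k) $ (j, l) = B $ (i, k) $ (j, l)"
  shows "A = B"
  using assms by (simp add: vec_eq_iff)

definition pvec :: "complex^'m::finite \<Rightarrow> complex^'n::finite \<Rightarrow> complex^('m \<times> 'n)" where
  "pvec x y = (\<chi> p. x $ fst p * y $ snd p)"

text \<open>
  \<open>blk W Y\<close> is the partial trace of \<open>W (I \<otimes> Y)\<close> over the second factor, and \<open>block W\<close> is the
  linear map whose values at \<open>y y\<^sup>*\<close> are the compressions of \<open>W\<close> to \<open>y\<close> in the second factor.
\<close>

definition blk :: "(2 \<times> 2) op \<Rightarrow> herm2 \<Rightarrow> 2 \<Rightarrow> 2 \<Rightarrow> complex" where
  "blk W Y i j = W $ (i, 1) $ (j, 1) * of_real (fst Y) + W $ (i, 2) $ (j, 2) * of_real (fst (snd Y))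
    + W $ (i, 1) $ (j, 2) * cnj (snd (snd Y)) + W $ (i, 2) $ (j, 1) * snd (snd Y)"

definition block :: "(2 \<times> 2) op \<Rightarrow> herm2 \<Rightarrow> herm2" where
  "block W Y = (Re (blk W Y 1 1), Re (blk W Y 2 2), blk W Y 1 2)"

lemma qform_pvec:
  "qform W (pvec x y) = (\<Sum>i\<in>UNIV. \<Sum>j\<in>UNIV. cnj (x $ i) * blk W (ketbra y) i j * x $ j)"
  unfolding sform_def sum_UNIV_prod sum_2 pvec_def blk_def ketbra_def
  by (simp add: complex_norm_square algebra_simps del: of_real_power)

lemma hermitianD: "hermitian X \<Longrightarrow> cnj (X $ i $ j) = X $ j $ i"
  by (simp add: hermitian_iff)

lemma blk_cnj: "hermitian W \<Longrightarrow> cnj (blk W Y i j) = blk W Y j i"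
  by (simp add: blk_def hermitianD)

lemma Re_qform_pvec:
  assumes "hermitian W"
  shows "Re (qform W (pvec x y)) = hval (block W (ketbra y)) x"
proof -
  have *: "Im (blk W (ketbra y) i i) = 0" for i
    using blk_cnj[OF assms, of "ketbra y" i i] by (simp add: complex_eq_iff)
  have "blk W (ketbra y) 2 1 = cnj (blk W (ketbra y) 1 2)"
    by (simp add: blk_cnj[OF assms])
  then show ?thesis
    unfolding qform_pvec sum_2 hval_def block_def cmod_power2
    using *[of 1] *[of 2] by (simp add: algebra_simps power2_eq_square)
qed

definition block_positive :: "(2 \<times> 2) op \<Rightarrow> bool" where
  "block_positive W \<longleftrightarrow> hermitian W \<and> (\<forall>x y. 0 \<le> Re (qform W (pvec x y)))"

lemma block_positive_iff:
  "block_positive W \<longleftrightarrow> hermitian W \<and> (\<forall>y. hpos (block W (ketbra y)))"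
  by (auto simp: block_positive_def hpos_iff_hval Re_qform_pvec)

lemma linear_block: "linear (block W)"
  by (rule linearI) (simp_all add: block_def blk_def algebra_simps scaleR_conv_of_real)

lemma block_add: "block (W + W') Y = block W Y + block W' Y"
  and block_scaleR: "block (r *\<^sub>R W) Y = r *\<^sub>R block W Y"
  by (simp_all add: block_def blk_def algebra_simps scaleR_conv_of_real[where 'a = complex])

definition hop :: "herm2 \<Rightarrow> 2 op" where
  "hop X = (\<chi> i j. if i = 1 then if j = 1 then of_real (fst X) else snd (snd X)
    else if j = 1 then cnj (snd (snd X)) else of_real (fst (snd X)))"

lemma hermitian_hop: "hermitian (hop X)"
  by (auto simp: hermitian_iff hop_def forall_2)

lemma hop_eq_0_iff: "hop X = 0 \<longleftrightarrow> X = 0"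
  by (auto simp: hop_def vec_eq_iff forall_2 prod_eq_iff)

lemma hermitian_tensor: "hermitian A \<Longrightarrow> hermitian B \<Longrightarrow> hermitian (A \<otimes>\<^sub>o B)"
  by (auto simp: hermitian_iff tensor_op_def)

text \<open>The trace pairing counts the off-diagonal entry and its conjugate, while
  \<open>inner\<close> on triples counts it once; hence the half. Every perturbation
  \<open>inner v Y\<close> times \<open>u\<close> thus comes from a product operator.\<close>

lemma block_hop:
  "block (hop u \<otimes>\<^sub>o hop (fst v, fst (snd v), snd (snd v) / 2)) Y = inner v Y *\<^sub>R u"
  by (cases u; cases v; cases Y)
    (simp add: block_def blk_def hop_def tensor_op_def inner_complex_def complex_eq_iff field_simps)

section \<open>Decomposable operators and positivity of tensor products\<close>

definition decomposable :: "(2 \<times> 2) op \<Rightarrow> bool" where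
  "decomposable W \<longleftrightarrow> (\<exists>A B. psd A \<and> psd B \<and> W = A + partial_transpose B)"

lemma partial_transpose_nth: "partial_transpose B $ (i, k) $ (j, l) = B $ (i, l) $ (j, k)"
  by (simp add: partial_transpose_def id_tensor_def transpose_def)

lemma partial_transpose_add: "partial_transpose (A + B) = partial_transpose A + partial_transpose B"
  and partial_transpose_scaleR: "partial_transpose (r *\<^sub>R A) = r *\<^sub>R partial_transpose A"
  and partial_transpose_zero: "partial_transpose 0 = 0"
  by (simp_all add: vec_eq_iff partial_transpose_nth)

lemma decomposable_add:
  assumes "decomposable W" "decomposable W'"
  shows "decomposable (W + W')"
proof -
  obtain A B A' B' where "psd A" "psd B" "W = A + partial_transpose B"
    "psd A'" "psd B'" "W' = A' + partial_transpose B'"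
    using assms by (auto simp: decomposable_def)
  then have "psd (A + A')" "psd (B + B')" "W + W' = (A + A') + partial_transpose (B + B')"
    by (simp_all add: psd_add partial_transpose_add)
  then show ?thesis unfolding decomposable_def by blast
qed

lemma decomposable_scaleR:
  assumes "decomposable W" "0 \<le> r"
  shows "decomposable (r *\<^sub>R W)"
proof -
  obtain A B where "psd A" "psd B" "W = A + partial_transpose B"
    using assms by (auto simp: decomposable_def)
  then have "psd (r *\<^sub>R A)" "psd (r *\<^sub>R B)" "r *\<^sub>R W = r *\<^sub>R A + partial_transpose (r *\<^sub>R B)"
    using assms(2) by (simp_all add: psd_scaleR partial_transpose_scaleR scaleR_add_right)
  then show ?thesis unfolding decomposable_def by blast
qed

lemma psd_imp_decomposable: "psd W \<Longrightarrow> decomposable W"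
  unfolding decomposable_def using psd_zero partial_transpose_zero
  by (intro exI[of _ W] exI[of _ 0]) simp

text \<open>Cholesky factorisation: the first column over \<open>sqrt a\<close>, and the Schur
  complement \<open>c\<close> in the remaining corner. If \<open>a = 0\<close>, the determinant
  bound forces \<open>z = 0\<close>.\<close>

lemma psd_2_decompose:
  fixes X :: "2 op"
  assumes "psd X"
  obtains u v where "X = outer u + outer v"
proof -
  define a b z where "a = Re (X $ 1 $ 1)" and "b = Re (X $ 2 $ 2)" and "z = X $ 1 $ 2"
  have h: "cnj (X $ i $ j) = X $ j $ i" for i j
    using assms by (simp add: hermitianD psd_hermitian)
  have diag: "0 \<le> Re (X $ i $ i)" "Im (X $ i $ i) = 0" for i
    using assms sform_axis[of X i i] unfolding psd_iff by metis+
  then have ab: "0 \<le> a" "0 \<le> b" by (simp_all add: a_def b_def)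
  have X: "X $ 1 $ 1 = of_real a" "X $ 2 $ 2 = of_real b" "X $ 1 $ 2 = z" "X $ 2 $ 1 = cnj z"
    using diag(2)[of 1] diag(2)[of 2] h[of 1 2, symmetric]
    by (simp add: complex_eq_iff a_def, simp add: complex_eq_iff b_def, simp_all only: z_def)
  have det: "(cmod z)\<^sup>2 \<le> a * b"
    using psd_entry_bound[OF assms, of 1 2] by (simp add: X)
  show ?thesis
  proof (cases "a = 0")
    case True
    then have "z = 0" using det by simp
    have "X = outer (vector [0, of_real (sqrt b)]) + outer 0"
      using ab by (simp add: vec_eq_iff forall_2 outer_def X True \<open>z = 0\<close> flip: of_real_mult)
    then show ?thesis by (rule that)
  next
    case False
    then have "0 < a" using ab by simp
    define c where "c = b - (cmod z)\<^sup>2 / a"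
    have "0 \<le> c" using det \<open>0 < a\<close> by (simp add: c_def field_simps)
    have s: "of_real (sqrt a) * of_real (sqrt a) = complex_of_real a"
      "of_real (sqrt c) * of_real (sqrt c) = complex_of_real c"
      using \<open>0 < a\<close> \<open>0 \<le> c\<close> by (simp_all flip: of_real_mult)
    have s0: "complex_of_real (sqrt a) \<noteq> 0" using \<open>0 < a\<close> by simp
    have "cnj z / of_real (sqrt a) * (z / of_real (sqrt a)) + of_real (sqrt c) * of_real (sqrt c)
       = complex_of_real b"
    proof -
      have "cnj z * z = of_real ((cmod z)\<^sup>2)"
        using complex_norm_square[of z] by (simp add: mult.commute)
      then show ?thesis
        unfolding s times_divide_times_eq
        by (simp only: of_real_divide[symmetric] of_real_add[symmetric]) (simp add: c_def)
    qed
    then have "X = outer (vector [of_real (sqrt a), cnj z / of_real (sqrt a)])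
        + outer (vector [0, of_real (sqrt c)])"
      using s0 s by (simp add: vec_eq_iff forall_2 outer_def X)
    then show ?thesis by (rule that)
  qed
qed

lemma tensor_op_add_left: "(A + A') \<otimes>\<^sub>o B = A \<otimes>\<^sub>o B + A' \<otimes>\<^sub>o B"
  and tensor_op_add_right: "A \<otimes>\<^sub>o (B + B') = A \<otimes>\<^sub>o B + A \<otimes>\<^sub>o B'"
  and tensor_op_minus_minus: "(- A) \<otimes>\<^sub>o (- B) = A \<otimes>\<^sub>o B"
  and tensor_op_scaleR_left: "(r *\<^sub>R A) \<otimes>\<^sub>o B = r *\<^sub>R (A \<otimes>\<^sub>o B)"
  by (simp_all add: vec_eq_iff tensor_op_def algebra_simps)

lemma qform_outer_tensor:
  "qform (outer a \<otimes>\<^sub>o B) w = qform B (\<chi> k. \<Sum>i\<in>UNIV. cnj (a $ i) * w $ (i, k))"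
proof -
  have "qform (outer a \<otimes>\<^sub>o B) w = (\<Sum>i\<in>UNIV. \<Sum>k\<in>UNIV. \<Sum>j\<in>UNIV. \<Sum>l\<in>UNIV.
      a $ i * cnj (w $ (i, k)) * B $ k $ l * (cnj (a $ j) * w $ (j, l)))"
    unfolding sform_def sum_UNIV_prod by (simp add: tensor_op_def outer_def mult_ac)
  also have "\<dots> = (\<Sum>k\<in>UNIV. \<Sum>l\<in>UNIV. \<Sum>i\<in>UNIV. \<Sum>j\<in>UNIV.
      a $ i * cnj (w $ (i, k)) * B $ k $ l * (cnj (a $ j) * w $ (j, l)))"
    by (subst sum.swap, intro sum.cong refl)
      (subst sum.swap[of _ UNIV UNIV], subst (2) sum.swap, rule refl)
  also have "\<dots> = qform B (\<chi> k. \<Sum>i\<in>UNIV. cnj (a $ i) * w $ (i, k))"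
    unfolding sform_def by (simp add: sum_distrib_left sum_distrib_right mult_ac)
  finally show ?thesis .
qed

lemma psd_tensor:
  fixes A :: "2 op"
  assumes "psd A" "psd B"
  shows "psd (A \<otimes>\<^sub>o B)"
proof -
  have "psd (outer a \<otimes>\<^sub>o B)" for a :: "complex^2"
    using assms(2) by (simp add: psd_iff qform_outer_tensor)
  then show ?thesis
    using psd_2_decompose[OF assms(1)] by (metis tensor_op_add_left psd_add)
qed

lemma qform_tensor_pvec: "qform (A \<otimes>\<^sub>o B) (pvec x y) = qform A x * qform B y"
proof -
  have "qform (A \<otimes>\<^sub>o B) (pvec x y) = (\<Sum>i\<in>UNIV. \<Sum>k\<in>UNIV. \<Sum>j\<in>UNIV. \<Sum>l\<in>UNIV.
      (cnj (x $ i) * A $ i $ j * x $ j) * (cnj (y $ k) * B $ k $ l * y $ l))"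
    unfolding sform_def sum_UNIV_prod by (simp add: tensor_op_def pvec_def mult_ac)
  also have "\<dots> = (\<Sum>i\<in>UNIV. \<Sum>k\<in>UNIV. (\<Sum>j\<in>UNIV. cnj (x $ i) * A $ i $ j * x $ j)
      * (\<Sum>l\<in>UNIV. cnj (y $ k) * B $ k $ l * y $ l))"
    by (simp add: sum_product)
  also have "\<dots> = qform A x * qform B y"
    unfolding sform_def by (simp only: sum_product)
  finally show ?thesis .
qed

text \<open>On product vectors the form factorises, so nonzero factors are semidefinite of the same
  sign; two negative ones are replaced by their negatives.\<close>

lemma block_positive_tensor_psd:
  fixes A B :: "2 op"
  assumes A: "hermitian A" and B: "hermitian B"
    and pos: "\<And>x y. 0 \<le> Re (qform (A \<otimes>\<^sub>o B) (pvec x y))"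
  shows "psd (A \<otimes>\<^sub>o B)"
proof -
  have zero: "X = 0" if "hermitian X" "\<And>v. Re (qform X v) = 0" for X :: "2 op"
    using that by (intro sform_eq_zero_imp) (simp add: complex_eq_iff Im_qform_hermitian)
  have prod: "0 \<le> Re (qform A x) * Re (qform B y)" for x y
    using pos[of x y] by (simp add: qform_tensor_pvec Im_qform_hermitian[OF A])
  have main: "psd (A \<otimes>\<^sub>o B)" if hA: "hermitian A" and hB: "hermitian B"
    and pr: "\<And>x y. 0 \<le> Re (qform A x) * Re (qform B y)" and y: "0 < Re (qform B y)" for A B :: "2 op" and y
  proof -
    have "0 \<le> Re (qform A x)" for x
      using pr[of x y] y by (simp add: zero_le_mult_iff)
    then have "psd A" by (simp add: psd_iff Im_qform_hermitian[OF hA])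
    show ?thesis
    proof (cases "A = 0")
      case True
      then have "A \<otimes>\<^sub>o B = 0" by (simp add: tensor_op_def vec_eq_iff)
      then show ?thesis by simp
    next
      case False
      then obtain x where "0 < Re (qform A x)"
        using zero[OF hA] \<open>\<And>x. 0 \<le> Re (qform A x)\<close> by (metis less_eq_real_def)
      then have "0 \<le> Re (qform B y)" for y
        using pr[of x y] by (simp add: zero_le_mult_iff)
      then have "psd B" by (simp add: psd_iff Im_qform_hermitian[OF hB])
      then show ?thesis using psd_tensor \<open>psd A\<close> by blast
    qed
  qed
  show ?thesis
  proof (cases "\<exists>y. Re (qform B y) \<noteq> 0")
    case False
    then have "B = 0" using zero[OF B] by blast
    then have "A \<otimes>\<^sub>o B = 0" by (simp add: tensor_op_def vec_eq_iff)
    then show ?thesis by simp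
  next
    case True
    then obtain y where y: "Re (qform B y) \<noteq> 0" by blast
    show ?thesis
    proof (cases "0 < Re (qform B y)")
      case True
      then show ?thesis using main[OF A B prod] by blast
    next
      case False
      have "hermitian (- A)" "hermitian (- B)" using A B by (simp_all add: hermitian_iff)
      moreover have "0 \<le> Re (qform (- A) x) * Re (qform (- B) y)" for x y
        using prod[of x y] by (simp add: sform_minus_op)
      moreover have "0 < Re (qform (- B) y)" using y False by (simp add: sform_minus_op)
      ultimately show ?thesis using main[of "- A" "- B" y] by (simp add: tensor_op_minus_minus)
    qed
  qed
qed

section \<open>Forms dominated by a product of two functionals\<close>

abbreviation cdot :: "complex^2 \<Rightarrow> complex^2 \<Rightarrow> complex" where
  "cdot u x \<equiv> cnj (u $ 1) * x $ 1 + cnj (u $ 2) * x $ 2"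

lemma cross_terms_bound:
  assumes "\<And>b. cmod b = 1 \<Longrightarrow> cmod (b * p + cnj b * r) \<le> 1"
  shows "cmod p + cmod r \<le> 1"
proof -
  obtain w where w: "cmod w = 1" "p = of_real (cmod p) * w" by (rule phase)
  obtain w' where w': "cmod w' = 1" "r = of_real (cmod r) * w'" by (rule phase)
  \<comment> \<open>A square root of the relative phase of \<open>r\<close> and \<open>p\<close>, so
    that \<open>b * p\<close> and \<open>cnj b * r\<close> point in the same direction and their
    moduli add.\<close>
  define b where "b = csqrt (w' * cnj w)"
  have "cmod b ^ 2 = 1"
    by (simp add: b_def norm_mult w w' flip: norm_power)
  then have b: "cmod b = 1" by (simp add: power2_eq_1_iff) (metis norm_ge_zero neg_0_le_iff_le not_one_le_zero)
  have bb: "b * cnj b = 1" using complex_norm_square[of b] b by simp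
  have ww: "w * cnj w = 1" using complex_norm_square[of w] w by simp
  have "b * b = w' * cnj w" by (simp add: b_def power2_eq_square[symmetric])
  then have "w' * (w * cnj w) = b * b * w" by (simp add: mult_ac)
  then have "w' = b * b * w" by (simp add: ww)
  then have "cnj b * w' = (b * cnj b) * (b * w)" by (simp add: mult_ac)
  then have bw: "b * w = cnj b * w'" by (simp add: bb)
  have "b * p + cnj b * r = of_real (cmod p) * (b * w) + of_real (cmod r) * (cnj b * w')"
    using w(2) w'(2) by (metis mult.left_commute)
  also have "\<dots> = of_real (cmod p + cmod r) * (b * w)"
    unfolding bw by (simp add: distrib_right)
  finally have "b * p + cnj b * r = of_real (cmod p + cmod r) * (b * w)" .
  then have "cmod (b * p + cnj b * r) = \<bar>cmod p + cmod r\<bar> * (cmod b * cmod w)"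
    by (simp only: norm_mult norm_of_real)
  then show ?thesis using assms[OF b] b w(1) by simp
qed

text \<open>
  The off-diagonal corner \<open>Z\<close> of a block-positive operator with diagonal corners \<open>u u\<^sup>*\<close> and \<open>v v\<^sup>*\<close>
  satisfies \<open>\<bar>x\<^sup>* Z x\<bar> \<le> \<bar>u\<^sup>* x\<bar> \<bar>v\<^sup>* x\<bar>\<close>. Such a \<open>Z\<close> is \<open>p u v\<^sup>* + r v u\<^sup>*\<close> with \<open>\<bar>p\<bar> + \<bar>r\<bar> \<le> 1\<close>: the
  first term belongs to the positive summand, the second one to the partially transposed one.
\<close>

lemma dominated_form_independent:
  fixes Z :: "2 op"
  assumes dom: "\<And>x. cmod (qform Z x) \<le> cmod (cdot u x) * cmod (cdot v x)"
    and indep: "u $ 1 * v $ 2 - u $ 2 * v $ 1 \<noteq> 0"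
  obtains p r where "cmod p + cmod r \<le> 1"
    "\<And>i j. Z $ i $ j = p * (u $ i * cnj (v $ j)) + r * (v $ i * cnj (u $ j))"
proof -
  define D where "D = cnj (u $ 1 * v $ 2 - u $ 2 * v $ 1)"
  have D: "D \<noteq> 0" using indep unfolding D_def complex_cnj_zero_iff .
  \<comment> \<open>The basis dual to \<open>u\<close>, \<open>v\<close>. In it the bound reads
    \<open>cmod a * cmod b\<close>, which kills the diagonal entries of \<open>Z\<close> and leaves
    only \<open>p\<close> and \<open>r\<close>.\<close>
  define u' :: "complex^2" where "u' = vector [cnj (v $ 2) / D, - cnj (v $ 1) / D]"
  define v' :: "complex^2" where "v' = vector [- cnj (u $ 2) / D, cnj (u $ 1) / D]"
  have dual: "cdot u u' = 1" "cdot v u' = 0" "cdot u v' = 0" "cdot v v' = 1"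
    using D by (simp_all add: u'_def v'_def divide_simps) (simp_all add: D_def algebra_simps)
  have comb: "cdot w (a *s u' + b *s v') = a * cdot w u' + b * cdot w v'" for w a b
    by (simp add: algebra_simps)
  have bound: "cmod (qform Z (a *s u' + b *s v')) \<le> cmod a * cmod b" for a b
    using dom[of "a *s u' + b *s v'"] unfolding comb dual by simp
  have c11: "qform Z u' = 0" using bound[of 1 0] by simp
  have c22: "qform Z v' = 0" using bound[of 0 1] by simp
  define p r where "p = sform Z u' v'" and "r = sform Z v' u'"
  have "cmod p + cmod r \<le> 1"
  proof (rule cross_terms_bound)
    fix b :: complex assume "cmod b = 1"
    then show "cmod (b * p + cnj b * r) \<le> 1"
      using bound[of 1 b]
      by (simp add: sform_add_left sform_add_right sform_scale_left sform_scale_right c11 c22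
          p_def r_def add.commute)
  qed
  moreover have "Z $ i $ j = p * (u $ i * cnj (v $ j)) + r * (v $ i * cnj (u $ j))" for i j
  proof -
    have "axis j 1 = cnj (u $ j) *s u' + cnj (v $ j) *s v'" for j
      using D exhaust_2[of j]
      by (auto simp: vec_eq_iff forall_2 axis_def u'_def v'_def divide_simps)
        (simp_all add: D_def algebra_simps)
    then have "Z $ i $ j = sform Z (cnj (u $ i) *s u' + cnj (v $ i) *s v')
        (cnj (u $ j) *s u' + cnj (v $ j) *s v')"
      by (metis sform_axis)
    then show ?thesis
      by (simp add: sform_add_left sform_add_right sform_scale_left sform_scale_right c11 c22
          p_def r_def)
  qed
  ultimately show ?thesis by (rule that)
qed

text \<open>The bound is quadratic in the component along \<open>u\<close>. Near the orthogonal
  vector \<open>w\<close> the mixed entries contribute to first order and must therefore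
  vanish.\<close>

lemma dominated_form_parallel:
  fixes Z :: "2 op"
  assumes dom: "\<And>x. cmod (qform Z x) \<le> cmod k * (cmod (cdot u x))\<^sup>2" and "u \<noteq> 0"
  obtains c where "cmod c \<le> cmod k" "\<And>i j. Z $ i $ j = c * (u $ i * cnj (u $ j))"
proof -
  define N where "N = cdot u u"
  have N: "N = of_real ((norm u)\<^sup>2)"
    using qform_mat[of u] by (simp add: N_def sform_mat sum_2)
  then have N0: "N \<noteq> 0" using \<open>u \<noteq> 0\<close> by simp
  have cN: "cnj N = N" by (simp add: N)
  define u' :: "complex^2" where "u' = (1 / N) *s u"
  define w :: "complex^2" where "w = vector [- cnj (u $ 2), cnj (u $ 1)]"
  have dual: "cdot u u' = 1" "cdot u w = 0"
  proof -
    have "cdot u u' = cdot u u / N" by (simp add: u'_def add_divide_distrib)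
    then show "cdot u u' = 1" using N0 by (simp add: N_def[symmetric])
    show "cdot u w = 0" by (simp add: w_def)
  qed
  have comb: "cdot u (a *s u' + b *s w) = a" for a b
  proof -
    have "cdot u (a *s u' + b *s w) = a * cdot u u' + b * cdot u w" by (simp add: algebra_simps)
    then show ?thesis unfolding dual by simp
  qed
  have bound: "cmod (qform Z (a *s u' + b *s w)) \<le> cmod k * (cmod a)\<^sup>2" for a b
    using dom[of "a *s u' + b *s w"] unfolding comb .
  have c22: "qform Z w = 0" using bound[of 0 1] by simp
  define c where "c = qform Z u'"
  define p r where "p = sform Z u' w" and "r = sform Z w u'"
  \<comment> \<open>Divide the bound at \<open>t * s *s u' + w\<close> by \<open>t\<close> and let
    \<open>t\<close> tend to 0; the phases 1 and \<open>i\<close> then separate \<open>p\<close>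
    from \<open>r\<close>.\<close>
  have mixed: "cnj s * p + s * r = 0" if s: "cmod s = 1" for s
  proof -
    have "cmod (cnj s * p + s * r) \<le> t * (cmod k + cmod c)" if "0 < t" for t
    proof -
      have ss: "s * cnj s = 1" using complex_norm_square[of s] s by simp
      have "qform Z ((of_real t * s) *s u' + 1 *s w)
          = of_real t * (cnj s * p + s * r) + of_real (t\<^sup>2) * (s * cnj s) * c"
        by (simp add: sform_add_left sform_add_right sform_scale_left sform_scale_right c22
            p_def r_def c_def algebra_simps power2_eq_square)
      then have "of_real t * (cnj s * p + s * r)
          = qform Z ((of_real t * s) *s u' + 1 *s w) - of_real (t\<^sup>2) * c"
        by (simp add: ss)
      then have "cmod (of_real t * (cnj s * p + s * r))
          \<le> cmod (qform Z ((of_real t * s) *s u' + 1 *s w)) + cmod (of_real (t\<^sup>2) * c)"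
        by (metis norm_triangle_ineq4)
      also have "\<dots> \<le> cmod k * t\<^sup>2 + t\<^sup>2 * cmod c"
        using bound[of "of_real t * s" 1] that s by (simp add: norm_mult norm_power)
      finally have "t * cmod (cnj s * p + s * r) \<le> t * (t * (cmod k + cmod c))"
        unfolding norm_mult norm_of_real using that
        by (simp add: power2_eq_square distrib_left mult_ac)
      then show ?thesis using that by simp
    qed
    note le = this
    have "cmod (cnj s * p + s * r) \<le> 0"
    proof (rule field_le_epsilon)
      fix e :: real assume "0 < e"
      define K where "K = cmod k + cmod c + 1"
      have "0 < K" by (simp add: K_def add_nonneg_pos)
      have "cmod (cnj s * p + s * r) \<le> e / K * (cmod k + cmod c)"
        using \<open>0 < e\<close> \<open>0 < K\<close> by (intro le) simp
      also have "\<dots> \<le> e / K * K"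
        using \<open>0 < e\<close> \<open>0 < K\<close> by (intro mult_left_mono) (auto simp: K_def)
      finally show "cmod (cnj s * p + s * r) \<le> 0 + e" using \<open>0 < K\<close> by simp
    qed
    then show ?thesis by simp
  qed
  have pr: "p = 0" "r = 0"
  proof -
    have sum: "p + r = 0" using mixed[of 1] by simp
    have "\<i> * (r - p) = 0" using mixed[of \<i>] by (simp add: right_diff_distrib)
    then have "r = p" by simp
    then show "p = 0" "r = 0" using sum by simp_all
  qed
  have "cmod c \<le> cmod k" using bound[of 1 0] by (simp add: c_def)
  moreover have "Z $ i $ j = c * (u $ i * cnj (u $ j))" for i j
  proof -
    \<comment> \<open>The coordinate of the standard basis vector \<open>e_j\<close> along
      \<open>w\<close>.\<close>
    define g where "g j = (if j = 1 then - u $ 2 / N else u $ 1 / N)" for j :: 2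
    have "axis j 1 = cnj (u $ j) *s u' + g j *s w" for j
    proof -
      have "axis 1 1 = cnj (u $ 1) *s u' + g 1 *s w" "axis 2 1 = cnj (u $ 2) *s u' + g 2 *s w"
        using N0 by (simp_all add: vec_eq_iff forall_2 axis_def g_def u'_def w_def divide_simps)
          (simp_all add: N_def mult.commute add.commute)
      then show ?thesis using exhaust_2[of j] by auto
    qed
    then have "Z $ i $ j = sform Z (cnj (u $ i) *s u' + g i *s w) (cnj (u $ j) *s u' + g j *s w)"
      by (metis sform_axis)
    then show ?thesis
      by (simp add: sform_add_left sform_add_right sform_scale_left sform_scale_right c22
          p_def[symmetric] r_def[symmetric] pr c_def)
  qed
  ultimately show ?thesis by (rule that)
qed

lemma dominated_form:
  fixes Z :: "2 op"
  assumes dom: "\<And>x. cmod (qform Z x) \<le> cmod (cdot u x) * cmod (cdot v x)"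
  obtains p r where "cmod p + cmod r \<le> 1"
    "\<And>i j. Z $ i $ j = p * (u $ i * cnj (v $ j)) + r * (v $ i * cnj (u $ j))"
proof (cases "u $ 1 * v $ 2 - u $ 2 * v $ 1 = 0")
  case False
  then show ?thesis using dominated_form_independent[OF dom] that by blast
next
  case True
  show ?thesis
  proof (cases "u = 0")
    case True
    then have "Z = 0" using dom by (intro sform_eq_zero_imp) simp
    then show ?thesis by (intro that[of 0 0]) simp_all
  next
    case False
    define k where "k = (if u $ 1 = 0 then v $ 2 / u $ 2 else v $ 1 / u $ 1)"
    have v: "v = k *s u"
      using True False by (auto simp: vec_eq_iff forall_2 k_def field_simps)
    have "cmod (cdot v x) = cmod k * cmod (cdot u x)" for x
    proof -
      have "cdot v x = cnj k * cdot u x" by (simp add: v algebra_simps)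
      then show ?thesis by (simp add: norm_mult)
    qed
    then have "cmod (qform Z x) \<le> cmod k * (cmod (cdot u x))\<^sup>2" for x
      using dom[of x] by (simp add: power2_eq_square mult_ac)
    then obtain c where c: "cmod c \<le> cmod k" "\<And>i j. Z $ i $ j = c * (u $ i * cnj (u $ j))"
      using dominated_form_parallel[of Z k u] False by blast
    show ?thesis
    \<comment> \<open>Since \<open>v = k *s u\<close>, the matrix \<open>u v*\<close> is
      \<open>cnj k\<close> times \<open>u u*\<close>. For \<open>k = 0\<close> the quotient is 0,
      which is right because the bound then gives \<open>c = 0\<close>.\<close>
    proof (rule that[of "c / cnj k" 0])
      show "cmod (c / cnj k) + cmod 0 \<le> 1" using c(1) by (simp add: norm_divide divide_le_eq_1)
      show "Z $ i $ j = c / cnj k * (u $ i * cnj (v $ j)) + 0 * (v $ i * cnj (u $ j))" for i j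
        using c by (cases "k = 0") (simp_all add: v)
    qed
  qed
qed

text \<open>The vector \<open>u \<otimes> e_1 + v \<otimes> e_2\<close>.\<close>

definition jvec :: "complex^2 \<Rightarrow> complex^2 \<Rightarrow> complex^(2 \<times> 2)" where
  "jvec u v = (\<chi> p. if snd p = 1 then u $ fst p else v $ fst p)"

lemma hop_ketbra: "hop (ketbra u) = outer u"
  by (simp add: hop_def ketbra_def outer_def vec_eq_iff forall_2 complex_norm_square mult.commute
      del: of_real_power)

lemma corner_eq:
  assumes "hermitian W"
  shows "W $ (i, 1) $ (j, 1) = hop (block W (1, 0, 0)) $ i $ j"
    and "W $ (i, 2) $ (j, 2) = hop (block W (0, 1, 0)) $ i $ j"
proof -
  have "Im (W $ q $ q) = 0" for q
    using hermitianD[OF assms, of q q] by (simp add: complex_eq_iff)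
  then have diag: "of_real (Re (W $ q $ q)) = W $ q $ q" for q
    by (simp add: complex_eq_iff)
  show "W $ (i, 1) $ (j, 1) = hop (block W (1, 0, 0)) $ i $ j"
    and "W $ (i, 2) $ (j, 2) = hop (block W (0, 1, 0)) $ i $ j"
    using exhaust_2[of i] exhaust_2[of j]
    by (auto simp: hop_def block_def blk_def diag hermitianD[OF assms])
qed

text \<open>For fixed \<open>x\<close>, the form at \<open>pvec x y\<close> is a Hermitian form in
  \<open>y\<close> with diagonal entries the two values of \<open>hval\<close> and off-diagonal
  entry \<open>x* Z x\<close>; its determinant is nonnegative.\<close>

lemma corner_bound:
  assumes W: "block_positive W"
  shows "(cmod (qform (\<chi> i j. W $ (i, 1) $ (j, 2)) x))\<^sup>2
    \<le> hval (block W (1, 0, 0)) x * hval (block W (0, 1, 0)) x"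
proof -
  have h: "hermitian W" and pos: "\<And>x y. 0 \<le> Re (qform W (pvec x y))"
    using W by (auto simp: block_positive_def)
  define Z :: "2 op" where "Z = (\<chi> i j. W $ (i, 1) $ (j, 2))"
  define P R where "P = block W (1, 0, 0)" and "R = block W (0, 1, 0)"
  have hval_lin: "hval (X + Y) x = hval X x + hval Y x" "hval (a *\<^sub>R X) x = a * hval X x" for X Y x a
    by (simp_all add: hval_def algebra_simps)
  have hvalZ: "hval (block W (0, 0, z)) x = 2 * Re (cnj z * qform Z x)" for z x
    using h[THEN hermitianD, of "(1, 2)" "(1, 1)", symmetric] h[THEN hermitianD, of "(2, 2)" "(2, 1)", symmetric]
     h[THEN hermitianD, of "(1, 2)" "(2, 1)", symmetric] h[THEN hermitianD, of "(2, 2)" "(1, 1)", symmetric]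
    unfolding hval_def block_def blk_def sform_def sum_2 Z_def
    by (simp add: cmod_power2) (simp add: power2_eq_square algebra_simps)
  have expand: "Re (qform W (pvec x (vector [s, t])))
      = (cmod s)\<^sup>2 * hval P x + (cmod t)\<^sup>2 * hval R x + 2 * Re (cnj s * t * qform Z x)"
    for x s t
  proof -
    have "ketbra (vector [s, t]) = (cmod s)\<^sup>2 *\<^sub>R (1, 0, 0) + (cmod t)\<^sup>2 *\<^sub>R (0, 1, 0) + (0, 0, s * cnj t)"
      by (simp add: ketbra_def)
    then have "block W (ketbra (vector [s, t])) = (cmod s)\<^sup>2 *\<^sub>R P + (cmod t)\<^sup>2 *\<^sub>R R
        + block W (0, 0, s * cnj t)"
      by (simp only: linear_add[OF linear_block] linear_cmul[OF linear_block] P_def R_def)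
    then show ?thesis
      by (simp add: Re_qform_pvec[OF h] hval_lin hvalZ mult_ac)
  qed
  obtain w where w: "cmod w = 1" "qform Z x = of_real (cmod (qform Z x)) * w" by (rule phase)
  have wq: "cnj w * qform Z x = of_real (cmod (qform Z x))"
    using w(1) complex_norm_square[of w] by (subst w(2)) (simp add: mult_ac)
  have "(cmod (qform Z x))\<^sup>2 \<le> hval P x * hval R x"
  proof (rule quadratic_nonneg_discriminant)
    show "0 \<le> hval R x" using pos[of x "vector [0, 1]"] unfolding expand by simp
    show "0 \<le> hval P x + 2 * t * cmod (qform Z x) + t\<^sup>2 * hval R x" for t
    proof -
      have eq: "cnj 1 * (of_real t * cnj w) * qform Z x = of_real (t * cmod (qform Z x))"
        using wq by simp
      show ?thesis
        using pos[of x "vector [1, of_real t * cnj w]"] unfolding expand eq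
        by (simp add: norm_mult w(1))
    qed
  qed
  then show ?thesis by (simp add: Z_def P_def R_def)
qed

text \<open>The partial transpose swaps the off-diagonal corners. Hence a rank-one \<open>A\<close>
  part of weight \<open>cmod p\<close> yields the term with \<open>u v*\<close>, a rank-one
  \<open>B\<close> of weight \<open>cmod r\<close> the term with \<open>v u*\<close>, and the
  remaining weight fills up the diagonal corners.\<close>

lemma decomposable_corners:
  assumes W: "block_positive W"
    and u: "block W (1, 0, 0) = ketbra u" and v: "block W (0, 1, 0) = ketbra v"
  shows "decomposable W"
proof -
  have h: "hermitian W" using W by (simp add: block_positive_def)
  define Z :: "2 op" where "Z = (\<chi> i j. W $ (i, 1) $ (j, 2))"
  have "cmod (qform Z x) \<le> cmod (cdot u x) * cmod (cdot v x)" for x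
  proof -
    have "(cmod (qform Z x))\<^sup>2 \<le> (cmod (cdot u x) * cmod (cdot v x))\<^sup>2"
      using corner_bound[OF W, of x] by (simp only: hval_ketbra power_mult_distrib u v Z_def)
    then show ?thesis by (rule power2_le_imp_le) simp
  qed
  then obtain p r where pr: "cmod p + cmod r \<le> 1"
    and Z: "\<And>i j. Z $ i $ j = p * (u $ i * cnj (v $ j)) + r * (v $ i * cnj (u $ j))"
    using dominated_form[of Z u v] by blast
  obtain w where w: "cmod w = 1" "p = of_real (cmod p) * w" by (rule phase)
  obtain w' where w': "cmod w' = 1" "r = of_real (cmod r) * w'" by (rule phase)
  have ww: "w * cnj w = 1" "w' * cnj w' = 1"
    using complex_norm_square[of w] complex_norm_square[of w'] w w' by simp_all
  define A where "A = cmod p *\<^sub>R outer (jvec u (cnj w *s v))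
    + (1 - cmod p - cmod r) *\<^sub>R (outer (jvec u 0) + outer (jvec 0 v))"
  define B where "B = cmod r *\<^sub>R outer (jvec u (w' *s v))"
  have "psd A" unfolding A_def using pr by (intro psd_add psd_scaleR psd_outer) auto
  moreover have "psd B" unfolding B_def by (intro psd_scaleR psd_outer) auto
  moreover have "W = A + partial_transpose B"
  proof (rule op_2x2_eqI)
    fix i k j l :: 2
    have corner: "W $ (i, 1) $ (j, 1) = u $ i * cnj (u $ j)" "W $ (i, 2) $ (j, 2) = v $ i * cnj (v $ j)" for i j
      by (simp_all add: corner_eq[OF h] u v hop_ketbra) (simp_all add: outer_def)
    have off: "W $ (i, 1) $ (j, 2) = of_real (cmod p) * (u $ i * (w * cnj (v $ j)))
        + of_real (cmod r) * (w' * v $ i * cnj (u $ j))" for i j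
    proof -
      have eq: "p * c = of_real (cmod p) * (w * c)" "r * c = of_real (cmod r) * (w' * c)" for c
        by (subst w(2), simp add: mult.assoc) (subst w'(2), simp add: mult.assoc)
      show ?thesis using Z[of i j] unfolding eq by (simp add: Z_def mult_ac)
    qed
    have off': "W $ (i, 2) $ (j, 1) = of_real (cmod p) * (cnj w * v $ i * cnj (u $ j))
        + of_real (cmod r) * (u $ i * cnj (w' * v $ j))" for i j
      unfolding hermitianD[OF h, of "(j, 1)" "(i, 2)", symmetric] off by (simp add: mult_ac)
    consider "k = 1" "l = 1" | "k = 1" "l = 2" | "k = 2" "l = 1" | "k = 2" "l = 2"
      using exhaust_2 by blast
    then show "W $ (i, k) $ (j, l) = (A + partial_transpose B) $ (i, k) $ (j, l)"
    proof cases
      case 1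
      then show ?thesis unfolding A_def B_def
        by (simp add: corner partial_transpose_nth outer_def jvec_def scaleR_conv_of_real[where 'a = complex]) (simp add: algebra_simps)
    next
      case 2
      then show ?thesis unfolding A_def B_def
        by (simp add: off partial_transpose_nth outer_def jvec_def scaleR_conv_of_real[where 'a = complex])
    next
      case 3
      then show ?thesis unfolding A_def B_def
        by (simp add: off' partial_transpose_nth outer_def jvec_def scaleR_conv_of_real[where 'a = complex])
    next
      case 4
      have cancel: "w * (cnj w * c) = c" "w' * (cnj w' * c) = c" for c
        by (simp_all add: ww mult.assoc[symmetric])
      show ?thesis using 4 unfolding A_def B_def
        by (simp add: corner partial_transpose_nth outer_def jvec_def scaleR_conv_of_real[where 'a = complex]) (simp add: algebra_simps cancel)
    qed
  qed
  ultimately show ?thesis unfolding decomposable_def by blast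
qed

section \<open>The trace-one slice of the block-positive cone and its extreme points\<close>

lemma trace_corners:
  assumes "hermitian W"
  shows "trace W = of_real (fst (block W (1, 0, 0)) + fst (snd (block W (1, 0, 0)))
    + fst (block W (0, 1, 0)) + fst (snd (block W (0, 1, 0))))"
  unfolding trace_def sum_UNIV_prod sum_2 corner_eq[OF assms]
  by (simp add: hop_def)

lemma hpos_corners:
  assumes "block_positive W"
  shows "hpos (block W (1, 0, 0))" "hpos (block W (0, 1, 0))"
proof -
  have "ketbra (axis 1 1) = (1, 0, 0)" "ketbra (axis 2 1) = (0, 1, 0)"
    by (simp_all add: ketbra_def axis_def)
  then show "hpos (block W (1, 0, 0))" "hpos (block W (0, 1, 0))"
    using assms unfolding block_positive_iff by metis+
qed

lemma block_positive_trace: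
  assumes "block_positive W"
  shows "0 \<le> Re (trace W)" "trace W = of_real (Re (trace W))"
  using trace_corners[of W] hpos_corners[OF assms] assms
  by (auto simp: block_positive_def hpos_def)

text \<open>Both diagonal corners are positive and traceless, hence zero, and
  \<open>corner_bound\<close> then kills the off-diagonal ones. This makes the trace-one slice a
  base of the cone.\<close>

lemma block_positive_trace_zero:
  assumes W: "block_positive W" and tr: "Re (trace W) = 0"
  shows "W = 0"
proof -
  have h: "hermitian W" using W by (simp add: block_positive_def)
  let ?P = "block W (1, 0, 0)" and ?R = "block W (0, 1, 0)"
  have "fst ?P = 0 \<and> fst (snd ?P) = 0 \<and> fst ?R = 0 \<and> fst (snd ?R) = 0"
    using tr hpos_corners[OF W] unfolding trace_corners[OF h] hpos_def Re_complex_of_real by linarith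
  moreover from this have "snd (snd ?P) = 0 \<and> snd (snd ?R) = 0"
    using hpos_corners[OF W] by (simp add: hpos_def dform_self)
  ultimately have PR: "?P = 0" "?R = 0" by (simp_all add: prod_eq_iff)
  define Z :: "2 op" where "Z = (\<chi> i j. W $ (i, 1) $ (j, 2))"
  have "qform Z x = 0" for x
    using corner_bound[OF W, of x] by (simp add: PR hval_def Z_def)
  then have "Z = 0" by (rule sform_eq_zero_imp)
  then have off: "W $ (i, 1) $ (j, 2) = 0" for i j
    by (simp add: Z_def vec_eq_iff)
  have off': "W $ (i, 2) $ (j, 1) = 0" for i j
    using hermitianD[OF h, of "(j, 1)" "(i, 2)"] off[of j i] by simp
  have "hop 0 = 0" by (simp add: hop_eq_0_iff)
  then have corner: "W $ (i, 1) $ (j, 1) = 0" "W $ (i, 2) $ (j, 2) = 0" for i j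
    unfolding corner_eq[OF h] PR by simp_all
  show "W = 0"
  proof (rule op_2x2_eqI)
    fix i k j l :: 2
    show "W $ (i, k) $ (j, l) = 0 $ (i, k) $ (j, l)"
      using exhaust_2[of k] exhaust_2[of l] corner off off' by auto
  qed
qed

lemma block_positive_scaleR: "block_positive W \<Longrightarrow> 0 \<le> r \<Longrightarrow> block_positive (r *\<^sub>R W)"
  by (simp add: block_positive_def sform_scaleR_op hermitian_iff)

lemma continuous_on_trace [continuous_intros]:
  assumes "continuous_on S f"
  shows "continuous_on S (\<lambda>x. trace (f x :: 'n::finite op))"
  unfolding trace_def by (intro continuous_on_sum continuous_on_component assms)

lemma closed_block_positive: "closed {W. block_positive W}"
  unfolding block_positive_def hermitian_iff
  by (intro closed_Collect_conj closed_Collect_all closed_Collect_eq closed_Collect_le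
      continuous_intros continuous_on_component)

text \<open>On the part of the cone in the unit sphere the continuous trace is positive, so it has a
  positive minimum \<open>m\<close> there; rescaling bounds the slice by
  \<open>1 / m\<close>.\<close>

lemma compact_block_positive: "compact {W. block_positive W \<and> trace W = 1}"
proof -
  define K where "K = {W. block_positive W} \<inter> sphere 0 1"
  have "compact K"
    unfolding K_def by (intro closed_Int_compact closed_block_positive compact_sphere)
  have pos: "0 < Re (trace W)" if "W \<in> K" for W
  proof -
    have "W \<noteq> 0" "block_positive W" using that by (auto simp: K_def)
    then show ?thesis using block_positive_trace_zero block_positive_trace(1) by force
  qed
  have normal: "(1 / norm W) *\<^sub>R W \<in> K" if "block_positive W" "trace W = 1" for W
  proof -
    have "W \<noteq> 0" using that(2) by (auto simp: trace_def)
    then show ?thesis using that by (simp add: K_def block_positive_scaleR)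
  qed
  have "bounded {W. block_positive W \<and> trace W = 1}"
  proof (cases "K = {}")
    case True
    then have "{W. block_positive W \<and> trace W = 1} = {}" using normal by blast
    then show ?thesis by (metis bounded_empty)
  next
    case False
    have "continuous_on K (\<lambda>W. Re (trace W))" by (intro continuous_intros)
    then obtain W0 where W0: "W0 \<in> K" "\<And>W. W \<in> K \<Longrightarrow> Re (trace W0) \<le> Re (trace W)"
      using continuous_attains_inf[OF \<open>compact K\<close> False] by metis
    define m where "m = Re (trace W0)"
    have "0 < m" using pos W0(1) by (simp add: m_def)
    have "norm W \<le> 1 / m" if "block_positive W" "trace W = 1" for W
    proof -
      have "0 < norm W" using that(2) by (auto simp: trace_def)
      have "m \<le> Re (trace ((1 / norm W) *\<^sub>R W))" unfolding m_def by (intro W0 normal that)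
      also have "\<dots> = 1 / norm W * Re (trace W)"
        by (simp add: trace_def sum_distrib_left sum_divide_distrib)
      finally show ?thesis using that(2) \<open>0 < norm W\<close> \<open>0 < m\<close> by (simp add: field_simps)
    qed
    then show ?thesis unfolding bounded_iff by blast
  qed
  moreover have "closed {W. block_positive W \<and> trace W = 1}"
    by (intro closed_Collect_conj closed_block_positive closed_Collect_eq continuous_intros)
  ultimately show ?thesis by (simp add: compact_eq_bounded_closed)
qed

lemma convex_block_positive: "convex {W. block_positive W \<and> trace W = 1}"
proof (rule convexI)
  fix W W' and s t :: real
  assume W: "W \<in> {W. block_positive W \<and> trace W = 1}" "W' \<in> {W. block_positive W \<and> trace W = 1}"
    and st: "0 \<le> s" "0 \<le> t" "s + t = 1"
  have "block_positive (s *\<^sub>R W + t *\<^sub>R W')"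
    using W st by (simp add: block_positive_def hermitian_iff sform_add_op sform_scaleR_op)
  moreover have "trace (s *\<^sub>R W + t *\<^sub>R W') = s *\<^sub>R trace W + t *\<^sub>R trace W'"
    by (simp add: trace_def sum.distrib scaleR_sum_right)
  ultimately show "s *\<^sub>R W + t *\<^sub>R W' \<in> {W. block_positive W \<and> trace W = 1}"
    using W st by (simp flip: scaleR_add_left)
qed

lemma extreme_decomposable:
  assumes "W extreme_point_of {W. block_positive W \<and> trace W = 1}"
  shows "decomposable W"
proof -
  let ?S = "{W. block_positive W \<and> trace W = 1}"
  have W: "block_positive W" "trace W = 1"
    and ext: "\<And>A B. A \<in> ?S \<Longrightarrow> B \<in> ?S \<Longrightarrow> W \<notin> open_segment A B"
    using assms by (auto simp: extreme_point_of_def)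
  have h: "hermitian W" and hp: "\<And>y. hpos (block W (ketbra y))"
    using W by (auto simp: block_positive_iff)
  show ?thesis
  proof (rule perturbation[OF linear_block hp])
    fix m assume m: "\<And>X. dform (block W X) (block W X) = m * dform X X"
    \<comment> \<open>The diagonal matrix units are singular, so their images are singular and
      positive, that is, of rank at most one.\<close>
    have "dform (block W (1, 0, 0)) (block W (1, 0, 0)) = 0" "dform (block W (0, 1, 0)) (block W (0, 1, 0)) = 0"
      unfolding m by (simp_all add: dform_self)
    then obtain u v where "block W (1, 0, 0) = ketbra u" "block W (0, 1, 0) = ketbra v"
      using hpos_null hpos_corners[OF W(1)] by metis
    then show ?thesis by (rule decomposable_corners[OF W(1)])
  next
    fix u v r
    assume "u \<noteq> 0" "v \<noteq> 0" "0 < r"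
      and pert: "\<And>s y. \<bar>s\<bar> \<le> r \<Longrightarrow> hpos (block W (ketbra y) + s *\<^sub>R inner v (ketbra y) *\<^sub>R u)"
    define V where "V = hop (fst v, fst (snd v), snd (snd v) / 2)"
    define N where "N = hop u \<otimes>\<^sub>o V"
    have hN: "hermitian N" unfolding N_def V_def by (intro hermitian_tensor hermitian_hop)
    have bN: "block N Y = inner v Y *\<^sub>R u" for Y unfolding N_def V_def by (rule block_hop)
    have "N \<noteq> 0"
    proof
      assume "N = 0"
      moreover have "block 0 v = 0" by (simp add: block_def blk_def prod_eq_iff)
      ultimately show False using bN[of v] \<open>u \<noteq> 0\<close> \<open>v \<noteq> 0\<close> by simp
    qed
    have pos: "block_positive (W + s *\<^sub>R N)" if "\<bar>s\<bar> \<le> r" for s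
    proof -
      have "hermitian (W + s *\<^sub>R N)" using h hN by (simp add: hermitian_iff)
      then show ?thesis using pert[OF that] by (simp add: block_positive_iff block_add block_scaleR bN)
    qed
    define \<tau> where "\<tau> = Re (trace N)"
    have trN: "trace N = of_real \<tau>"
      unfolding \<tau>_def trace_corners[OF hN] by simp
    \<comment> \<open>The second bound gives \<open>\<bar>s * \<tau>\<bar> < 1\<close>, so both
      perturbed operators keep positive trace and can be normalised.\<close>
    define s where "s = min r (1 / (\<bar>\<tau>\<bar> + 1))"
    have s: "0 < s" "\<bar>s\<bar> \<le> r" using \<open>0 < r\<close> by (auto simp: s_def)
    have "\<bar>s * \<tau>\<bar> \<le> 1 / (\<bar>\<tau>\<bar> + 1) * \<bar>\<tau>\<bar>"
      unfolding abs_mult using s by (intro mult_right_mono) (auto simp: s_def)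
    also have "\<dots> < 1" by (simp add: divide_less_eq)
    finally have st: "\<bar>s * \<tau>\<bar> < 1" .
    define W1 where "W1 = (1 / (1 + s * \<tau>)) *\<^sub>R (W + s *\<^sub>R N)"
    define W2 where "W2 = (1 / (1 - s * \<tau>)) *\<^sub>R (W + (- s) *\<^sub>R N)"
    have tr: "trace (a *\<^sub>R (W + b *\<^sub>R N)) = of_real (a * (1 + b * \<tau>))" for a b
    proof -
      have "trace (a *\<^sub>R (W + b *\<^sub>R N)) = a *\<^sub>R (trace W + b *\<^sub>R trace N)"
        by (simp add: trace_def sum.distrib scaleR_sum_right scaleR_add_right)
      then show ?thesis by (simp add: W(2) trN scaleR_conv_of_real)
    qed
    have "W1 \<in> ?S" unfolding W1_def using st s tr[of "1 / (1 + s * \<tau>)" s]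
      by (auto intro!: block_positive_scaleR pos)
    moreover have "W2 \<in> ?S" unfolding W2_def using st s tr[of "1 / (1 - s * \<tau>)" "- s"]
      by (auto intro!: block_positive_scaleR pos simp del: scaleR_minus_left)
    ultimately have "W \<notin> open_segment W1 W2" by (rule ext)
    \<comment> \<open>The weights \<open>(1 + s * \<tau>) / 2\<close> and
      \<open>(1 - s * \<tau>) / 2\<close> undo the normalisations, so \<open>N\<close> cancels.
      Extremality leaves only \<open>W1 = W2\<close>, which makes \<open>N\<close> a multiple of
      \<open>W\<close>.\<close>
    moreover have "W = (1 - (1 - s * \<tau>) / 2) *\<^sub>R W1 + ((1 - s * \<tau>) / 2) *\<^sub>R W2"
    proof -
      have "(1 - (1 - s * \<tau>) / 2) *\<^sub>R W1 = (1 / 2) *\<^sub>R (W + s *\<^sub>R N)"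
        "((1 - s * \<tau>) / 2) *\<^sub>R W2 = (1 / 2) *\<^sub>R (W + (- s) *\<^sub>R N)"
        using st by (simp_all add: W1_def W2_def divide_simps del: scaleR_minus_left)
      then have "(1 - (1 - s * \<tau>) / 2) *\<^sub>R W1 + ((1 - s * \<tau>) / 2) *\<^sub>R W2
          = (1 / 2) *\<^sub>R W + (1 / 2) *\<^sub>R W"
        by (simp only: scaleR_add_right scaleR_minus_left scaleR_minus_right) simp
      then show ?thesis by (simp flip: scaleR_add_left)
    qed
    moreover have "0 < (1 - s * \<tau>) / 2" "(1 - s * \<tau>) / 2 < 1" using st by auto
    ultimately have "W1 = W2" unfolding in_segment(2) by blast
    with \<open>W = _\<close> have "W = W1" by (simp flip: scaleR_add_left)
    then have "(1 + s * \<tau>) *\<^sub>R W = (1 + s * \<tau>) *\<^sub>R W1" by simp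
    also have "\<dots> = W + s *\<^sub>R N" using st by (simp add: W1_def)
    finally have "s *\<^sub>R (\<tau> *\<^sub>R W) = s *\<^sub>R N" by (simp add: algebra_simps)
    then have N: "\<tau> *\<^sub>R W = N" using s(1) unfolding scaleR_cancel_left by simp
    then have "\<tau> \<noteq> 0" using \<open>N \<noteq> 0\<close> by auto
    then have "W = (1 / \<tau>) *\<^sub>R N" by (simp flip: N)
    then have tensor: "W = ((1 / \<tau>) *\<^sub>R hop u) \<otimes>\<^sub>o V" by (simp add: N_def tensor_op_scaleR_left)
    have "hermitian ((1 / \<tau>) *\<^sub>R hop u)" using hermitian_hop[of u] by (simp add: hermitian_iff)
    then have "psd W"
      using W(1) unfolding block_positive_def tensor V_def
      by (intro block_positive_tensor_psd hermitian_hop) auto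
    then show ?thesis by (rule psd_imp_decomposable)
  qed
qed

lemma Stormer_Woronowicz:
  assumes W: "block_positive W"
  shows "decomposable W"
proof (cases "Re (trace W) = 0")
  case True
  then show ?thesis using block_positive_trace_zero[OF W] by (simp add: psd_imp_decomposable)
next
  case False
  define t where "t = Re (trace W)"
  let ?S = "{W. block_positive W \<and> trace W = 1}"
  have t: "0 < t" using False block_positive_trace(1)[OF W] by (simp add: t_def)
  have "trace ((1 / t) *\<^sub>R W) = (1 / t) *\<^sub>R trace W"
    by (simp add: trace_def scaleR_sum_right)
  also have "\<dots> = 1"
    using t by (subst block_positive_trace(2)[OF W]) (simp add: scaleR_conv_of_real flip: t_def)
  finally have "(1 / t) *\<^sub>R W \<in> ?S"
    using W t by (simp add: block_positive_scaleR)
  also have "?S = convex hull {W. W extreme_point_of ?S}"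
    by (rule Krein_Milman_Minkowski[OF compact_block_positive convex_block_positive])
  also have "\<dots> \<subseteq> {W. decomposable W}"
  proof (rule hull_minimal)
    show "{W. W extreme_point_of ?S} \<subseteq> {W. decomposable W}"
      using extreme_decomposable by blast
    show "convex {W. decomposable W}"
      by (rule convexI) (simp add: decomposable_add decomposable_scaleR)
  qed
  finally have "decomposable ((1 / t) *\<^sub>R W)" by simp
  from decomposable_scaleR[OF this, of t] show ?thesis using t by simp
qed

subsection \<open>Separable states and witnesses\<close>

definition product_states :: "(2 \<times> 2 \<times> 2) op set" where
  "product_states = {a \<otimes>\<^sub>o b \<otimes>\<^sub>o c |a b c. state a \<and> state b \<and> state c}"

lemma scale_op_of_real: "scale_op (of_real r) X = r *\<^sub>R X"
  by (simp add: scale_op_def vec_eq_iff scaleR_conv_of_real[where 'a = complex])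

lemma continuous_on_tensor_op [continuous_intros]:
  assumes "continuous_on S f" "continuous_on S g"
  shows "continuous_on S (\<lambda>x. f x \<otimes>\<^sub>o g x)"
  unfolding tensor_op_def
  by (intro continuous_on_vec_lambda continuous_on_mult continuous_on_component assms)

lemma compact_states: "compact {X :: 'n::finite op. state X}"
proof -
  have "norm X \<le> 1" if "state X" for X :: "'n op"
    using norm_le_trace[of X] that by (simp add: state_def)
  then have "bounded {X :: 'n op. state X}" unfolding bounded_iff by blast
  moreover have "closed {X :: 'n op. state X}"
    unfolding state_def psd_iff
    by (intro closed_Collect_conj closed_Collect_all closed_Collect_eq closed_Collect_le
        continuous_intros)
  ultimately show ?thesis by (simp add: compact_eq_bounded_closed)
qed

lemma compact_product_states: "compact product_states"
proof -
  have eq: "product_states = (\<lambda>x. fst x \<otimes>\<^sub>o fst (snd x) \<otimes>\<^sub>o snd (snd x))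
      ` ({X. state X} \<times> {X. state X} \<times> {X. state X})"
    by (force simp: product_states_def image_iff)
  show ?thesis
    unfolding eq
    by (intro compact_continuous_image compact_Times compact_states continuous_intros)
qed

text \<open>In finite dimension the convex hull of a compact set is compact, so limits of product
  mixtures are themselves finite mixtures; conversely such a mixture approximates itself with error
  zero.\<close>

lemma separable_iff_convex_hull: "separable \<rho> \<longleftrightarrow> \<rho> \<in> convex hull product_states"
proof
  assume sep: "separable \<rho>"
  have "\<exists>s \<in> convex hull product_states. dist s \<rho> < e" if "0 < e" for e
  proof -
    from sep[unfolded separable_def, rule_format, OF that] obtain k p and \<rho>1 \<rho>2 \<rho>3 :: "nat \<Rightarrow> 2 op" where
      states: "\<forall>i<k. 0 \<le> p i \<and> state (\<rho>1 i) \<and> state (\<rho>2 i) \<and> state (\<rho>3 i)"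
      and sum: "(\<Sum>i<k. p i) = 1"
      and less: "trace_norm (\<rho> - (\<Sum>i<k. scale_op (of_real (p i)) (\<rho>1 i \<otimes>\<^sub>o \<rho>2 i \<otimes>\<^sub>o \<rho>3 i))) < e"
      by (elim exE conjE) (rule that; assumption)
    let ?s = "\<Sum>i<k. p i *\<^sub>R (\<rho>1 i \<otimes>\<^sub>o \<rho>2 i \<otimes>\<^sub>o \<rho>3 i)"
    have hull: "?s \<in> convex hull product_states"
    proof (rule convex_sum)
      show "\<rho>1 i \<otimes>\<^sub>o \<rho>2 i \<otimes>\<^sub>o \<rho>3 i \<in> convex hull product_states" if "i \<in> {..<k}" for i
        using states that by (intro hull_inc) (auto simp: product_states_def)
    qed (use states sum in auto)
    have "norm (\<rho> - ?s) < e"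
      using less norm_le_trace_norm[of "\<rho> - ?s"] by (simp add: scale_op_of_real)
    then have "dist ?s \<rho> < e" by (simp only: dist_norm norm_minus_commute)
    then show ?thesis using hull by (rule bexI)
  qed
  then have "\<rho> \<in> closure (convex hull product_states)"
    unfolding closure_approachable by blast
  then show "\<rho> \<in> convex hull product_states"
    using compact_convex_hull[OF compact_product_states] by (simp add: compact_imp_closed)
next
  assume "\<rho> \<in> convex hull product_states"
  then obtain k :: nat and u and y where uy: "\<forall>i\<in>{1..k}. 0 \<le> u i \<and> y i \<in> product_states"
    "sum u {1..k} = 1" "(\<Sum>i = 1..k. u i *\<^sub>R y i) = \<rho>"
    unfolding convex_hull_indexed by blast
  \<comment> \<open>The hull is indexed by \<open>{1..k}\<close> and \<open>separable\<close> by
    \<open>i < k\<close>, hence the shift by \<open>Suc\<close>.\<close>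
  have "\<exists>a b c. state a \<and> state b \<and> state c \<and> y (Suc i) = a \<otimes>\<^sub>o b \<otimes>\<^sub>o c" if "i < k" for i
    using uy(1) that by (force simp: product_states_def)
  then obtain a b c where abc:
    "\<And>i. i < k \<Longrightarrow> state (a i) \<and> state (b i) \<and> state (c i) \<and> y (Suc i) = a i \<otimes>\<^sub>o b i \<otimes>\<^sub>o c i"
    by metis
  have "(\<Sum>i<k. scale_op (of_real (u (Suc i))) (a i \<otimes>\<^sub>o b i \<otimes>\<^sub>o c i)) = (\<Sum>i<k. u (Suc i) *\<^sub>R y (Suc i))"
    using abc by (intro sum.cong) (auto simp: scale_op_of_real)
  also have "\<dots> = \<rho>" using uy(3) by (simp add: sum.atLeast1_atMost_eq)
  finally have "trace_norm (\<rho> - (\<Sum>i<k. scale_op (of_real (u (Suc i))) (a i \<otimes>\<^sub>o b i \<otimes>\<^sub>o c i))) = 0"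
    by simp
  moreover have "(\<Sum>i<k. u (Suc i)) = 1" using uy(2) by (simp add: sum.atLeast1_atMost_eq)
  moreover have "\<forall>i<k. 0 \<le> u (Suc i) \<and> state (a i) \<and> state (b i) \<and> state (c i)"
    using uy(1) abc by auto
  ultimately show "separable \<rho>"
    unfolding separable_def
    by (intro allI impI exI[of _ k] exI[of _ "\<lambda>i. u (Suc i)"] exI[of _ a] exI[of _ b] exI[of _ c]) auto
qed

section \<open>Separable states pass every test\<close>

lemma hs_inner_add_right: "hs_inner X (Y + Z) = hs_inner X Y + hs_inner X Z"
  by (simp add: hs_inner_eq_sum sum.distrib algebra_simps)

lemma hs_inner_outer_left: "hs_inner (outer u) X = qform X u"
  by (simp add: hs_inner_eq_sum sform_def outer_def mult_ac)

lemma outer_tensor_outer: "outer u \<otimes>\<^sub>o outer v = outer (pvec u v)"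
  by (simp add: tensor_op_def outer_def pvec_def vec_eq_iff mult_ac)

text \<open>On product vectors, transposing the second factor amounts to conjugating the second
  vector; this is why decomposable operators are positive on product vectors.\<close>

lemma qform_partial_transpose:
  fixes B :: "(2 \<times> 2) op"
  shows "qform (partial_transpose B) (pvec x y) = qform B (pvec x (\<chi> k. cnj (y $ k)))"
  unfolding sform_def sum_UNIV_prod sum_2
  by (simp add: partial_transpose_nth pvec_def algebra_simps)

lemma decomposable_hs_inner_nonneg:
  assumes X: "decomposable X" and b: "psd b" and c: "psd c"
  shows "hs_inner X (b \<otimes>\<^sub>o c) \<in> \<real>\<^sub>\<ge>\<^sub>0"
proof -
  obtain A B where AB: "psd A" "psd B" "X = A + partial_transpose B"
    using X by (auto simp: decomposable_def)
  have nonneg: "hs_inner X (outer u \<otimes>\<^sub>o outer v) \<in> \<real>\<^sub>\<ge>\<^sub>0" for u v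
    using AB(1,2) unfolding outer_tensor_outer hs_inner_outer AB(3) sform_add_op qform_partial_transpose
    by (simp add: psd_iff complex_nonneg_Reals_iff)
  obtain b1 b2 c1 c2 where "b = outer b1 + outer b2" "c = outer c1 + outer c2"
    using psd_2_decompose[OF b] psd_2_decompose[OF c] by metis
  then show ?thesis
    by (simp add: tensor_op_add_left tensor_op_add_right hs_inner_add_right nonneg nonneg_Reals_add_I)
qed

text \<open>By adjointness the form of \<open>\<Lambda> (b \<otimes> c)\<close> at a unit vector
  \<open>x\<close> pairs a decomposable operator with a product. Positivity thus holds on product
  states and extends to their hull because it is a convex condition.\<close>

lemma psd_id_tensor_of_separable:
  fixes \<Lambda> :: "(2 \<times> 2) op \<Rightarrow> 2 op"
  assumes "separable \<rho>" and \<Lambda>: "linear_op \<Lambda>"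
    and dec: "\<And>\<sigma>. state \<sigma> \<Longrightarrow> decomposable (hs_adjoint \<Lambda> \<sigma>)"
  shows "psd (id_tensor \<Lambda> \<rho>)"
proof -
  have "linear_op (id_tensor \<Lambda> :: (2 \<times> 2 \<times> 2) op \<Rightarrow> _)" by (rule linear_op_id_tensor[OF \<Lambda>])
  then have add: "id_tensor \<Lambda> (X + Y) = id_tensor \<Lambda> X + id_tensor \<Lambda> Y"
    and scaleR: "id_tensor \<Lambda> (r *\<^sub>R X) = r *\<^sub>R id_tensor \<Lambda> X"
    for X Y :: "(2 \<times> 2 \<times> 2) op" and r
    unfolding linear_op_iff scale_op_of_real[symmetric] by blast+
  have "psd (\<Lambda> (b \<otimes>\<^sub>o c))" if "state b" "state c" for b c
  proof (rule psd_normalized)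
    fix x :: "complex^2" assume "norm x = 1"
    then have "hs_inner (hs_adjoint \<Lambda> (outer x)) (b \<otimes>\<^sub>o c) \<in> \<real>\<^sub>\<ge>\<^sub>0"
      using that by (intro decomposable_hs_inner_nonneg dec state_outer) (auto simp: state_def)
    then show "qform (\<Lambda> (b \<otimes>\<^sub>o c)) x \<in> \<real>\<^sub>\<ge>\<^sub>0"
      by (simp add: hs_inner_hs_adjoint[OF \<Lambda>] hs_inner_outer_left)
  qed
  then have "product_states \<subseteq> {X. psd (id_tensor \<Lambda> X)}"
    by (auto simp: product_states_def id_tensor_tensor_op[OF \<Lambda>] state_def intro!: psd_tensor)
  moreover have "convex {X :: (2 \<times> 2 \<times> 2) op. psd (id_tensor \<Lambda> X)}"
    by (intro convexI) (simp add: add scaleR psd_add psd_scaleR)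
  ultimately have "convex hull product_states \<subseteq> {X. psd (id_tensor \<Lambda> X)}"
    by (rule hull_minimal)
  then show ?thesis using assms(1) by (auto simp: separable_iff_convex_hull)
qed

section \<open>Entanglement witnesses and their Choi maps\<close>

lemma trace_tensor: "trace (A \<otimes>\<^sub>o B) = trace A * trace B"
  by (simp add: trace_def tensor_op_def sum_UNIV_prod sum_product)

lemma inner_dagger_hermitian:
  assumes "hermitian X"
  shows "inner (dagger W) X = inner W X"
proof -
  have "inner (dagger W) X = (\<Sum>i\<in>UNIV. \<Sum>j\<in>UNIV. inner (W $ j $ i) (cnj (X $ i $ j)))"
    by (simp add: inner_vec_def dagger_def inner_complex_def)
  also have "\<dots> = (\<Sum>i\<in>UNIV. \<Sum>j\<in>UNIV. inner (W $ j $ i) (X $ j $ i))"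
    using assms by (simp add: hermitian_iff)
  also have "\<dots> = inner W X"
    unfolding inner_vec_def by (rule sum.swap)
  finally show ?thesis .
qed

lemma inner_mat: "inner (mat 1 :: 'n::finite op) X = Re (trace X)"
proof -
  have "dagger (mat 1) = (mat 1 :: 'n op)" by (simp add: dagger_def mat_def vec_eq_iff)
  then show ?thesis unfolding Re_hs_inner[symmetric] hs_inner_def by simp
qed

lemma psd_scaled_state:
  fixes X :: "'n::finite op"
  assumes "psd X"
  obtains r Y where "0 \<le> r" "state Y" "X = r *\<^sub>R Y"
proof (cases "X = 0")
  case True
  have "norm (axis i 1 :: complex^'n) = 1" for i
    by (intro norm_Basis) (simp add: axis_in_Basis_iff Basis_complex_def)
  then show ?thesis using True that[of 0 "outer (axis undefined 1)"] by (simp add: state_outer)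
next
  case False
  define t where "t = Re (trace X)"
  have t: "0 < t" using norm_le_trace[OF assms] False unfolding t_def
    by (metis less_le_trans zero_less_norm_iff)
  have "Im (X $ i $ i) = 0" for i
    using assms sform_axis[of X i i] unfolding psd_iff by metis
  then have "Im (trace X) = 0" by (simp add: trace_def)
  then have "trace X = of_real t" by (simp add: t_def complex_eq_iff)
  then have "trace ((1 / t) *\<^sub>R X) = 1"
    using t by (simp add: trace_def scaleR_conv_of_real[where 'a = complex] flip: sum_divide_distrib)
  then have "state ((1 / t) *\<^sub>R X)" using t assms by (simp add: state_def psd_scaleR)
  then show ?thesis using t that[of t "(1 / t) *\<^sub>R X"] by simp
qed

lemma entanglement_witness:
  fixes \<rho> :: "(2 \<times> 2 \<times> 2) op"
  assumes "state \<rho>" "\<not> separable \<rho>"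
  obtains W where "hermitian W" "inner W \<rho> < 0"
    "\<And>a b c. psd a \<Longrightarrow> psd b \<Longrightarrow> psd c \<Longrightarrow> 0 \<le> inner W (a \<otimes>\<^sub>o b \<otimes>\<^sub>o c)"
proof -
  have "closed (convex hull product_states)"
    by (intro compact_imp_closed compact_convex_hull compact_product_states)
  then obtain V m where V: "inner V \<rho> < m" "\<And>s. s \<in> convex hull product_states \<Longrightarrow> m < inner V s"
    using separating_hyperplane_closed_point[OF convex_convex_hull] assms(2)
    unfolding separable_iff_convex_hull by metis
  \<comment> \<open>Averaging with the adjoint preserves pairings with Hermitian operators, and
    subtracting \<open>m\<close> times the identity moves the threshold to 0 at trace one.\<close>
  define W where "W = (1 / 2) *\<^sub>R (V + dagger V) - m *\<^sub>R mat 1"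
  have inner_W: "inner W X = inner V X - m" if "hermitian X" "trace X = 1" for X
    using inner_dagger_hermitian[OF that(1), of V] that(2)
    by (simp add: W_def inner_diff_left inner_add_left inner_mat)
  have "hermitian W"
    by (auto simp: W_def hermitian_iff dagger_def mat_def)
  moreover have "inner W \<rho> < 0"
    using inner_W[of \<rho>] V(1) assms(1) by (simp add: state_def psd_hermitian)
  moreover have "0 \<le> inner W (a \<otimes>\<^sub>o b \<otimes>\<^sub>o c)" if abc: "psd a" "psd b" "psd c" for a b c
  proof -
    obtain r a' where a: "0 \<le> r" "state a'" "a = r *\<^sub>R a'" using psd_scaled_state[OF abc(1)] .
    obtain s b' where b: "0 \<le> s" "state b'" "b = s *\<^sub>R b'" using psd_scaled_state[OF abc(2)] .
    obtain t c' where c: "0 \<le> t" "state c'" "c = t *\<^sub>R c'" using psd_scaled_state[OF abc(3)] .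
    let ?P = "a' \<otimes>\<^sub>o b' \<otimes>\<^sub>o c'"
    have "a \<otimes>\<^sub>o b \<otimes>\<^sub>o c = (r * s * t) *\<^sub>R ?P"
      unfolding a b c by (simp add: vec_eq_iff tensor_op_def)
    moreover have "0 < inner W ?P"
    proof -
      have "hermitian ?P" "trace ?P = 1"
        using a(2) b(2) c(2) by (simp_all add: state_def trace_tensor hermitian_tensor psd_hermitian)
      moreover have "?P \<in> convex hull product_states"
        using a(2) b(2) c(2) by (intro hull_inc) (auto simp: product_states_def)
      ultimately show ?thesis using V(2) inner_W by force
    qed
    ultimately show ?thesis using a(1) b(1) c(1) by simp
  qed
  ultimately show ?thesis by (rule that)
qed

text \<open>The entries are conjugated because \<open>hs_inner\<close> is conjugate-linear on the
  left: the adjoint then contains \<open>W\<close> itself, and testing at the maximally entangled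
  vector returns \<open>hs_inner W\<close>.\<close>

definition choi_map :: "(2 \<times> 'm::finite) op \<Rightarrow> 'm op \<Rightarrow> 2 op" where
  "choi_map W X = (\<chi> i j. \<Sum>k\<in>UNIV. \<Sum>l\<in>UNIV. cnj (W $ (i, k) $ (j, l)) * X $ k $ l)"

lemma linear_op_choi_map: "linear_op (choi_map W)"
  unfolding linear_op_iff choi_map_def
  by (simp add: vec_eq_iff scale_op_def algebra_simps sum.distrib sum_distrib_left)

lemma hs_adjoint_choi_map:
  "hs_adjoint (choi_map W) \<sigma> = (\<chi> k l. \<Sum>i\<in>UNIV. \<Sum>j\<in>UNIV. \<sigma> $ i $ j * W $ (i, k) $ (j, l))"
  (is "_ = ?M")
proof (rule hs_inner_cancel)
  fix Y
  have "hs_inner (hs_adjoint (choi_map W) \<sigma>) Y = hs_inner \<sigma> (choi_map W Y)"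
    by (rule hs_inner_hs_adjoint[OF linear_op_choi_map])
  also have "\<dots> = hs_inner ?M Y"
    by (simp add: hs_inner_eq_sum choi_map_def sum_2 sum.distrib sum_distrib_left algebra_simps)
  finally show "hs_inner (hs_adjoint (choi_map W) \<sigma>) Y = hs_inner ?M Y" .
qed

text \<open>The adjoint contracts \<open>W\<close> with the transpose of its argument, whence the
  conjugated vector.\<close>

lemma qform_hs_adjoint_outer:
  "qform (hs_adjoint (choi_map W) (outer u)) z = qform W (pvec (\<chi> i. cnj (u $ i)) z)"
  unfolding hs_adjoint_choi_map sform_def sum_UNIV_prod sum_2
  by (simp add: pvec_def outer_def sum.distrib sum_distrib_left algebra_simps)

text \<open>The test vector is the unnormalised maximally entangled
  \<open>e_1 \<otimes> e_1 + e_2 \<otimes> e_2\<close>; a negative pairing with \<open>W\<close>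
  thus becomes a negative value of the form.\<close>

lemma qform_id_tensor_choi_map:
  "qform (id_tensor (choi_map W) \<rho>) (\<chi> p. if fst p = snd p then 1 else 0) = hs_inner W \<rho>"
  unfolding sform_def hs_inner_eq_sum sum_UNIV_prod sum_2
  by (simp add: id_tensor_def choi_map_def sum.distrib algebra_simps)

lemma block_positive_hs_adjoint_choi_map:
  assumes W: "hermitian W"
    and pos: "\<And>a b c. psd a \<Longrightarrow> psd b \<Longrightarrow> psd c \<Longrightarrow> 0 \<le> inner W (a \<otimes>\<^sub>o b \<otimes>\<^sub>o c)"
    and \<sigma>: "psd \<sigma>"
  shows "block_positive (hs_adjoint (choi_map W) \<sigma>)"
  unfolding block_positive_def
proof (intro conjI allI)
  show "hermitian (hs_adjoint (choi_map W) \<sigma>)"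
    unfolding hs_adjoint_choi_map hermitian_iff
    by (simp add: sum_2 hermitianD[OF W] hermitianD[OF psd_hermitian[OF \<sigma>]])
  obtain u v where uv: "\<sigma> = outer u + outer v" using psd_2_decompose[OF \<sigma>] .
  have add: "hs_adjoint (choi_map W) (X + Y) = hs_adjoint (choi_map W) X + hs_adjoint (choi_map W) Y"
    for X Y
    by (simp add: hs_adjoint_choi_map vec_eq_iff sum.distrib algebra_simps)
  have nonneg: "0 \<le> Re (qform W (pvec w (pvec x y)))" for w x y
    using pos[OF psd_outer psd_outer psd_outer, of w x y]
    unfolding outer_tensor_outer Re_hs_inner[symmetric] hs_inner_outer by simp
  show "0 \<le> Re (qform (hs_adjoint (choi_map W) \<sigma>) (pvec x y))" for x y
    unfolding uv add sform_add_op qform_hs_adjoint_outer by (simp add: nonneg)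
qed

theorem theorem3:
  fixes \<rho> :: "(2 \<times> 2 \<times> 2) op"
  assumes "state \<rho>"
  shows "separable \<rho> \<longleftrightarrow>
    (\<forall>\<Lambda> :: (2 \<times> 2) op \<Rightarrow> 2 op.
      linear_op \<Lambda> \<longrightarrow>
      (\<forall>\<sigma> :: 2 op. state \<sigma> \<longrightarrow>
        (\<exists>A B :: (2 \<times> 2) op. psd A \<and> psd B \<and> hs_adjoint \<Lambda> \<sigma> = A + partial_transpose B)) \<longrightarrow>
      psd (id_tensor \<Lambda> \<rho>))"
  unfolding decomposable_def[symmetric]
proof (intro iffI allI impI)
  fix \<Lambda> :: "(2 \<times> 2) op \<Rightarrow> 2 op"
  assume "separable \<rho>" "linear_op \<Lambda>" "\<forall>\<sigma>. state \<sigma> \<longrightarrow> decomposable (hs_adjoint \<Lambda> \<sigma>)"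
  then show "psd (id_tensor \<Lambda> \<rho>)"
    by (intro psd_id_tensor_of_separable) auto
next
  assume test: "\<forall>\<Lambda> :: (2 \<times> 2) op \<Rightarrow> 2 op. linear_op \<Lambda> \<longrightarrow>
    (\<forall>\<sigma>. state \<sigma> \<longrightarrow> decomposable (hs_adjoint \<Lambda> \<sigma>)) \<longrightarrow> psd (id_tensor \<Lambda> \<rho>)"
  show "separable \<rho>"
  proof (rule ccontr)
    assume "\<not> separable \<rho>"
    then obtain W where W: "hermitian W" "inner W \<rho> < 0"
      "\<And>a b c. psd a \<Longrightarrow> psd b \<Longrightarrow> psd c \<Longrightarrow> 0 \<le> inner W (a \<otimes>\<^sub>o b \<otimes>\<^sub>o c)"
      using entanglement_witness[OF assms] by blast
    have "decomposable (hs_adjoint (choi_map W) \<sigma>)" if "state \<sigma>" for \<sigma>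
      using that unfolding state_def
      by (intro Stormer_Woronowicz block_positive_hs_adjoint_choi_map W) auto
    then have "psd (id_tensor (choi_map W) \<rho>)"
      using test linear_op_choi_map by blast
    then have "0 \<le> Re (hs_inner W \<rho>)"
      unfolding psd_iff qform_id_tensor_choi_map[symmetric] by blast
    then show False using W(2) by (simp add: Re_hs_inner)
  qed
qed

end
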